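(* There are universal constants $c>0$ and $T_0$ with the following property. Fix $T\ge T_0$, $W,R,\mu>0$, and $G\ge4\mu$, and set $D=W(1+3eR)$. On the scalar plant $x_{t+1}=u_t+w_t$, $x_1=0$, with tracking gain $K_0=0$, there is an oblivious distribution over disturbances and costs such that almost surely $|w_t|\le W$ for all $t$ and every cost is globally $\mu$-strongly convex and $(G,D)$-regular; moreover, every causal randomized controller satisfies $$\mathbb E\,\mathrm{Reg}_T(\mathfrak S(R))\ge c\,GDWR\sqrt{T\log(eT)}.$$ On this scalar plant the lower bound is matched up to universal constants by an upper bound: there are a universal constant $C$ and a causal controller with $\mathrm{Reg}_T(\mathfrak S(R))\le C\,GDWR\sqrt{T\log(eT)}$ for all disturbances bounded by $W$ and all $(G,D)$-regular convex costs.
   Context: Interaction: on round $t=1,\dots,T$ the controller observes $x_t$, chooses $u_t$ (possibly using private randomness), incurs $c_t(x_t,u_t)$, then observes the whole function $c_t$ and $x_{t+1}$ (hence $w_t$). Oblivious: disturbances and costs are drawn before play, independently of the controller's private randomness. System-level response ball on this plant ($A=0$, $B=1$, $K_0=0$): a response is a pair of real sequences $(\Phi_x^{[i]},\Phi_u^{[i]})_{i\ge1}$ with $\Phi_x^{[1]}=1$ and $\Phi_x^{[i+1]}=\Phi_u^{[i]}$. The baseline response has $\Phi_{0,x}^{[1]}=1$ and all other entries zero. $\mathfrak S(R)$ is the set of responses with $\sum_{i\ge1}\sqrt{(\Phi_x^{[i]}-\Phi_{0,x}^{[i]})^2+(\Phi_u^{[i]}-\Phi_{0,u}^{[i]})^2}\le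 R$. The trajectory of $\Phi$ on the realized disturbances is $y_t^\Phi=(x_t^\Phi,u_t^\Phi)$ with $x_t^\Phi=\sum_{i=1}^{t-1}\Phi_x^{[i]}w_{t-i}$, $u_t^\Phi=\sum_{i=1}^{t-1}\Phi_u^{[i]}w_{t-i}$, and $\mathrm{Reg}_T(\mathfrak S(R))=\sum_{t\le T}c_t(x_t,u_t)-\inf_{\Phi\in\mathfrak S(R)}\sum_{t\le T}c_t(y_t^\Phi)$. With $\|(x,u)\|^2=x^2+u^2$: a convex cost is $(G,D)$-regular if it is differentiable with $\|\nabla c_t\|\le GD$ on the radius-$D$ ball; globally $\mu$-strongly convex means $c(y')\ge c(y)+\langle\nabla c(y),y'-y\rangle+\frac\mu2\|y'-y\|^2$ for all $y,y'$. *)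

theory Defs
  imports "HOL-Probability.Probability"
begin

text \<open>Rounds are \<open>t = 1, \<dots>, T\<close>; the value of a sequence at index \<open>0\<close> is never used.\<close>

type_synonym cost = "real \<times> real \<Rightarrow> real"

text \<open>
  A policy maps what has been observed before \<open>u\<^sub>t\<close> is chosen, \<open>[x\<^sub>1, \<dots>, x\<^sub>t]\<close> and
  \<open>[c\<^sub>1, \<dots>, c\<^bsub>t-1\<^esub>]\<close>, to \<open>u\<^sub>t\<close>, so it is causal by its type. Past actions and past
  disturbances are functions of this data.
\<close>

type_synonym policy = "real list \<Rightarrow> cost list \<Rightarrow> real"

text \<open>\<open>states p w c n = [x\<^sub>1, \<dots>, x\<^bsub>n+1\<^esub>]\<close> in closed loop on the plant
  \<open>x\<^bsub>t+1\<^esub> = u\<^sub>t + w\<^sub>t\<close>, \<open>x\<^sub>1 = 0\<close>.\<close>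

primrec states :: "policy \<Rightarrow> (nat \<Rightarrow> real) \<Rightarrow> (nat \<Rightarrow> cost) \<Rightarrow> nat \<Rightarrow> real list" where
  "states p w c 0 = [0]"
| "states p w c (Suc n) =
     states p w c n @ [p (states p w c n) (map c [1..<Suc n]) + w (Suc n)]"

definition state :: "policy \<Rightarrow> (nat \<Rightarrow> real) \<Rightarrow> (nat \<Rightarrow> cost) \<Rightarrow> nat \<Rightarrow> real" where
  "state p w c t = last (states p w c (t - 1))"

definition action :: "policy \<Rightarrow> (nat \<Rightarrow> real) \<Rightarrow> (nat \<Rightarrow> cost) \<Rightarrow> nat \<Rightarrow> real" where
  "action p w c t = p (states p w c (t - 1)) (map c [1..<t])"

lemma state_1: "state p w c 1 = 0"
  by (simp add: state_def)

lemma state_Suc: "1 \<le> t \<Longrightarrow> state p w c (Suc t) = action p w c t + w t"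
  by (cases t) (simp_all add: state_def action_def)

lemma states_eq: "states p w c n = map (state p w c) [1..<n + 2]"
proof (induction n)
  case 0
  show ?case by (simp add: state_def)
next
  case (Suc n)
  have "states p w c (Suc n) = states p w c n @ [state p w c (n + 2)]"
    by (simp add: state_def)
  with Suc.IH show ?case
    by (simp only: add_Suc upt_Suc) simp
qed

text \<open>A response is the pair of sequences \<open>(\<Phi>\<^sub>x, \<Phi>\<^sub>u)\<close>, with relevant indices \<open>i \<ge> 1\<close>.\<close>

type_synonym response = "(nat \<Rightarrow> real) \<times> (nat \<Rightarrow> real)"

definition is_response :: "response \<Rightarrow> bool" where
  "is_response \<Phi> \<longleftrightarrow> fst \<Phi> 1 = 1 \<and> (\<forall>i\<ge>1. fst \<Phi> (i + 1) = snd \<Phi> i)"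

definition baseline :: response where
  "baseline = ((\<lambda>i. if i = 1 then 1 else 0), (\<lambda>i. 0))"

definition deviation :: "response \<Rightarrow> nat \<Rightarrow> real" where
  "deviation \<Phi> i =
     sqrt ((fst \<Phi> i - fst baseline i)\<^sup>2 + (snd \<Phi> i - snd baseline i)\<^sup>2)"

text \<open>The series is shifted by one because it runs over \<open>i \<ge> 1\<close>.\<close>

definition response_ball :: "real \<Rightarrow> response set" where
  "response_ball R = {\<Phi>. is_response \<Phi> \<and> summable (\<lambda>i. deviation \<Phi> (Suc i)) \<and>
                          (\<Sum>i. deviation \<Phi> (Suc i)) \<le> R}"

definition trajectory :: "response \<Rightarrow> (nat \<Rightarrow> real) \<Rightarrow> nat \<Rightarrow> real \<times> real" where
  "trajectory \<Phi> w t =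
     ((\<Sum>i = 1..t - 1. fst \<Phi> i * w (t - i)), (\<Sum>i = 1..t - 1. snd \<Phi> i * w (t - i)))"

text \<open>The infimum is a genuine one for \<open>R \<ge> 0\<close> and convex costs: the ball contains the baseline,
  and for fixed \<open>w\<close> its trajectories up to time \<open>T\<close> are bounded.\<close>

definition regret ::
    "nat \<Rightarrow> real \<Rightarrow> policy \<Rightarrow> (nat \<Rightarrow> real) \<Rightarrow> (nat \<Rightarrow> cost) \<Rightarrow> real" where
  "regret T R p w c =
     (\<Sum>t = 1..T. c t (state p w c t, action p w c t))
     - (INF \<Phi>\<in>response_ball R. \<Sum>t = 1..T. c t (trajectory \<Phi> w t))"

text \<open>The norm and inner product on \<open>real \<times> real\<close> are the Euclidean ones.\<close>

definition grad :: "cost \<Rightarrow> real \<times> real \<Rightarrow> real \<times> real" where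
  "grad f y = (THE g. GDERIV f y :> g)"

definition convex_differentiable :: "cost \<Rightarrow> bool" where
  "convex_differentiable f \<longleftrightarrow> convex_on UNIV f \<and> (\<forall>y. f differentiable (at y))"

definition regular_cost :: "real \<Rightarrow> real \<Rightarrow> cost \<Rightarrow> bool" where
  "regular_cost G D f \<longleftrightarrow>
     convex_differentiable f \<and> (\<forall>y. norm y \<le> D \<longrightarrow> norm (grad f y) \<le> G * D)"

definition strongly_convex :: "real \<Rightarrow> cost \<Rightarrow> bool" where
  "strongly_convex \<mu> f \<longleftrightarrow> (\<forall>y. f differentiable (at y)) \<and>
     (\<forall>y y'. f y' \<ge> f y + inner (grad f y) (y' - y) + \<mu> / 2 * (norm (y' - y))\<^sup>2)"

text \<open>
  Costs carry the sigma-algebra generated by the point evaluations. On convex (hence continuous)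
  functions it makes \<open>(f, y) \<mapsto> f y\<close> jointly measurable, which fails on all functions.
\<close>

definition cost_space :: "cost measure" where
  "cost_space = restrict_space (\<Pi>\<^sub>M y\<in>UNIV. borel) {f. convex_differentiable f}"

text \<open>An oblivious environment is a joint law of the disturbance and cost sequences. Its
  sigma-algebra may be finer than the one generated by the coordinates.\<close>

definition oblivious_law :: "nat \<Rightarrow> ((nat \<Rightarrow> real) \<times> (nat \<Rightarrow> cost)) measure \<Rightarrow> bool" where
  "oblivious_law T M \<longleftrightarrow> prob_space M \<and>
     (\<forall>t\<in>{1..T}. (\<lambda>(w, c). w t) \<in> M \<rightarrow>\<^sub>M borel) \<and>
     (\<forall>t\<in>{1..T}. (\<lambda>(w, c). c t) \<in> M \<rightarrow>\<^sub>M cost_space)"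

text \<open>
  A randomized controller is a policy depending on a private seed with law \<open>N\<close>, independent of the
  environment: the joint law of environment and seed is the product of \<open>M\<close> and \<open>N\<close>. Seeds are real
  sequences, which leaves room for a fresh draw in every round. The only regularity asked for is
  that the played actions are random variables; this holds for every policy that is jointly
  measurable in the seed, the observed states and the observed costs.
\<close>

definition randomized_controller ::
    "nat \<Rightarrow> ((nat \<Rightarrow> real) \<times> (nat \<Rightarrow> cost)) measure \<Rightarrow> (nat \<Rightarrow> real) measure \<Rightarrow>
     ((nat \<Rightarrow> real) \<Rightarrow> policy) \<Rightarrow> bool" where
  "randomized_controller T M N p \<longleftrightarrow> prob_space N \<and>
     (\<forall>t\<in>{1..T}. (\<lambda>((w, c), s). action (p s) w c t) \<in> (M \<Otimes>\<^sub>M N) \<rightarrow>\<^sub>M borel)"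

text \<open>
  Expectations with values in \<open>(-\<infinity>, \<infinity>]\<close>, for random variables with integrable negative part: a
  controller may have infinite expected regret, in which case the Bochner integral would be \<open>0\<close>.
\<close>

definition has_expectation :: "'a measure \<Rightarrow> ('a \<Rightarrow> real) \<Rightarrow> bool" where
  "has_expectation M X \<longleftrightarrow> X \<in> borel_measurable M \<and> (\<integral>\<^sup>+ z. ennreal (- X z) \<partial>M) < \<infinity>"

definition expect :: "'a measure \<Rightarrow> ('a \<Rightarrow> real) \<Rightarrow> ereal" where
  "expect M X =
     enn2ereal (\<integral>\<^sup>+ z. ennreal (X z) \<partial>M) - enn2ereal (\<integral>\<^sup>+ z. ennreal (- X z) \<partial>M)"

end

theory Submission
  imports Defs "HOL-Computational_Algebra.Polynomial" "HOL-Real_Asymp.Real_Asymp"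
begin

text \<open>
  Upper bound: the comparators lie in an \<open>\<ell>\<^sub>1\<close>-ball of gains, so exponential weights over the \<open>2 T\<close>
  vertices of that ball, run on the costs linearised at the actual trajectory, have regret
  \<open>O(G D W R sqrt (T ln T))\<close>. The state depends on the previous action, and the price of this memory
  is controlled by the \<open>\<ell>\<^sub>1\<close>-stability of exponential weights.

  Lower bound: the disturbances are a Rudin-Shapiro sequence and the costs are quadratics, centred
  at the state of the zero controller, plus a linear term in \<open>u\<^sub>t\<close> with a fresh random sign. No causal
  controller has negative expected cost. The comparator plays gains proportional to the softmax of
  the correlations between signs and shifted disturbances: spreading the mass over about \<open>sqrt N\<close> shifts
  keeps the quadratic cost of order \<open>sqrt N\<close>, because convolution with the sequence acts as if its
  spectrum were flat, while a second moment computation shows that the linear gain is of order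
  \<open>sqrt (N ln N)\<close>.
\<close>

section \<open>Exponential weights\<close>

text \<open>Strong convexity is what shapes the lower bound. With \<open>\<mu>\<close> as large as
  \<open>G / 4\<close>, a comparator that puts a gain of order \<open>R\<close> on the single best
  shift pays a quadratic cost of order \<open>\<mu> * W^2 * R^2 * N\<close>, linear in
  \<open>N\<close>, which can swamp a linear gain of order \<open>sqrt (N * ln N)\<close>. For gains
  proportional to \<open>R * p i\<close>, flatness reduces this cost to \<open>N\<close> times the
  sum of the \<open>(p i)^2\<close>. The softmax at \<open>\<eta>^2 = ln N / (4 * N)\<close> is the
  compromise: that sum is on average of order \<open>1 / sqrt N\<close>, while the collected
  correlation is still of order \<open>\<eta> * N\<close>, that is \<open>sqrt (N * ln N)\<close>.
  Flatness is used a second time: it makes distinct shifts nearly uncorrelated on average, so that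
  the partition function concentrates around its mean. The block length \<open>N\<close> is a power
  of two between \<open>T / 4\<close> and \<open>T / 2\<close>, so that \<open>N\<close> shifts of
  the block fit into the horizon. In the upper bound, the role of \<open>D\<close> is to contain the
  realised trajectory, at which all gradients are taken.\<close>

definition hedge :: "real \<Rightarrow> 'v set \<Rightarrow> (nat \<Rightarrow> 'v \<Rightarrow> real) \<Rightarrow> nat \<Rightarrow> 'v \<Rightarrow> real" where
  "hedge \<eta> V l t v =
     exp (- \<eta> * (\<Sum>s = 1..<t. l s v)) / (\<Sum>v'\<in>V. exp (- \<eta> * (\<Sum>s = 1..<t. l s v')))"

lemma hedge_nonneg: "0 \<le> hedge \<eta> V l t v"
  unfolding hedge_def by (intro divide_nonneg_nonneg sum_nonneg) auto

lemma hedge_normaliser_pos: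
  fixes l :: "nat \<Rightarrow> 'v \<Rightarrow> real"
  assumes "finite V" "V \<noteq> {}"
  shows "0 < (\<Sum>v\<in>V. exp (- \<eta> * (\<Sum>s = 1..<t. l s v)))"
  using assms by (intro sum_pos) auto

lemma sum_hedge:
  assumes "finite V" "V \<noteq> {}"
  shows "(\<Sum>v\<in>V. hedge \<eta> V l t v) = 1"
  using hedge_normaliser_pos[OF assms, of \<eta> l t]
  unfolding hedge_def sum_divide_distrib[symmetric] by simp

lemma exp_le_quadratic:
  fixes x :: real
  assumes "\<bar>x\<bar> \<le> 1"
  shows "exp x \<le> 1 + x + x\<^sup>2"
proof (cases "0 \<le> x")
  case True
  then show ?thesis using assms exp_bound[of x] by simp
next
  case False
  define y where "y = - x"
  have y: "0 < y" "y \<le> 1" using False assms by (auto simp: y_def)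
  \<comment> \<open>The first factor is the Taylor lower bound of \<open>exp y\<close>; replacing it
    by \<open>exp y\<close> and multiplying by \<open>exp (- y)\<close> gives the claim for the
    negative argument \<open>- y\<close>.\<close>
  have "1 \<le> (1 + y + y\<^sup>2 / 2) * (1 - y + y\<^sup>2)"
  proof -
    have "(1 + y + y\<^sup>2 / 2) * (1 - y + y\<^sup>2) = 1 + y\<^sup>2 / 2 + y ^ 3 / 2 + y ^ 4 / 2"
      by (simp add: field_simps power2_eq_square power3_eq_cube power4_eq_xxxx)
    then show ?thesis using y by simp
  qed
  also have "\<dots> \<le> exp y * (1 - y + y\<^sup>2)"
    using y exp_lower_Taylor_quadratic[of y] by (intro mult_right_mono) auto
  finally have "exp (- y) * 1 \<le> exp (- y) * (exp y * (1 - y + y\<^sup>2))"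
    by (intro mult_left_mono) auto
  also have "\<dots> = 1 - y + y\<^sup>2"
    by (simp add: mult.assoc[symmetric] exp_add[symmetric])
  finally show ?thesis by (simp add: y_def)
qed

lemma hedge_weight_Suc:
  fixes l :: "nat \<Rightarrow> 'v \<Rightarrow> real"
  assumes "1 \<le> t"
  shows "exp (- \<eta> * (\<Sum>s = 1..<Suc t. l s v)) = exp (- \<eta> * (\<Sum>s = 1..<t. l s v)) * exp (- \<eta> * l t v)"
  using assms by (simp add: exp_add[symmetric] algebra_simps)

lemma hedge_normaliser_Suc:
  fixes l :: "nat \<Rightarrow> 'v \<Rightarrow> real"
  assumes V: "finite V" "V \<noteq> {}" and t: "1 \<le> t"
  shows "(\<Sum>v\<in>V. exp (- \<eta> * (\<Sum>s = 1..<Suc t. l s v))) =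
    (\<Sum>v\<in>V. exp (- \<eta> * (\<Sum>s = 1..<t. l s v))) * (\<Sum>v\<in>V. hedge \<eta> V l t v * exp (- \<eta> * l t v))"
proof -
  define S where "S = (\<Sum>v\<in>V. exp (- \<eta> * (\<Sum>s = 1..<t. l s v)))"
  have "S \<noteq> 0" using hedge_normaliser_pos[OF V, of \<eta> l t] by (simp add: S_def)
  then show ?thesis
    unfolding hedge_weight_Suc[OF t] hedge_def S_def[symmetric] sum_distrib_left[of S]
    by (intro sum.cong refl) simp
qed

text \<open>Potential argument with the logarithm of the normaliser: each round lowers it by
  \<open>\<eta>\<close> times the mixture's loss, up to the second-order term
  \<open>\<eta>^2 * M^2\<close>, while at the end it is at least the log-weight of the single expert
  \<open>v\<^sub>0\<close>. The condition \<open>\<eta> * M \<le> 1\<close> keeps every exponent in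
  the range of \<open>exp_le_quadratic\<close>.\<close>

lemma hedge_regret:
  fixes l :: "nat \<Rightarrow> 'v \<Rightarrow> real"
  assumes V: "finite V" "v\<^sub>0 \<in> V" and \<eta>: "0 < \<eta>" "\<eta> * M \<le> 1"
    and l: "\<And>t v. t \<in> {1..T} \<Longrightarrow> v \<in> V \<Longrightarrow> \<bar>l t v\<bar> \<le> M"
  shows "(\<Sum>t = 1..T. \<Sum>v\<in>V. hedge \<eta> V l t v * l t v)
    \<le> (\<Sum>t = 1..T. l t v\<^sub>0) + ln (card V) / \<eta> + \<eta> * T * M\<^sup>2"
proof -
  define Z where "Z t = (\<Sum>v\<in>V. exp (- \<eta> * (\<Sum>s = 1..<t. l s v)))" for t
  have ne: "V \<noteq> {}" using V by auto
  have Zpos: "0 < Z t" for t unfolding Z_def by (rule hedge_normaliser_pos[OF V(1) ne])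
  have step: "ln (Z (Suc t)) \<le> ln (Z t) - \<eta> * (\<Sum>v\<in>V. hedge \<eta> V l t v * l t v) + \<eta>\<^sup>2 * M\<^sup>2"
    if t: "t \<in> {1..T}" for t
  proof -
    let ?p = "hedge \<eta> V l t"
    have "(\<Sum>v\<in>V. ?p v * exp (- \<eta> * l t v)) \<le> (\<Sum>v\<in>V. ?p v * (1 - \<eta> * l t v + \<eta>\<^sup>2 * M\<^sup>2))"
    proof (intro sum_mono mult_left_mono hedge_nonneg)
      fix v assume v: "v \<in> V"
      have lM: "\<bar>l t v\<bar> \<le> M" using l[OF t v] .
      have "\<bar>- \<eta> * l t v\<bar> \<le> \<eta> * M" using lM \<eta> by (simp add: abs_mult)
      then have "exp (- \<eta> * l t v) \<le> 1 + (- \<eta> * l t v) + (- \<eta> * l t v)\<^sup>2"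
        using \<eta> by (intro exp_le_quadratic) simp
      moreover have "(- \<eta> * l t v)\<^sup>2 \<le> \<eta>\<^sup>2 * M\<^sup>2"
        using lM by (simp add: power_mult_distrib mult_left_mono abs_le_square_iff[symmetric])
      ultimately show "exp (- \<eta> * l t v) \<le> 1 - \<eta> * l t v + \<eta>\<^sup>2 * M\<^sup>2" by simp
    qed
    also have "\<dots> = 1 + (- \<eta> * (\<Sum>v\<in>V. ?p v * l t v) + \<eta>\<^sup>2 * M\<^sup>2)"
      using sum_hedge[OF V(1) ne, of \<eta> l t]
      by (simp add: algebra_simps sum.distrib sum_subtractf sum_distrib_left sum_distrib_right[symmetric]
          flip: sum_distrib_left)
    also have "\<dots> \<le> exp (- \<eta> * (\<Sum>v\<in>V. ?p v * l t v) + \<eta>\<^sup>2 * M\<^sup>2)"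
      by (rule exp_ge_add_one_self)
    finally have "Z (Suc t) \<le> Z t * exp (- \<eta> * (\<Sum>v\<in>V. ?p v * l t v) + \<eta>\<^sup>2 * M\<^sup>2)"
      using t Zpos[of t] unfolding Z_def by (subst hedge_normaliser_Suc[OF V(1) ne]) auto
    then have "ln (Z (Suc t)) \<le> ln (Z t * exp (- \<eta> * (\<Sum>v\<in>V. ?p v * l t v) + \<eta>\<^sup>2 * M\<^sup>2))"
      using Zpos[of t] Zpos[of "Suc t"] by (subst ln_le_cancel_iff) auto
    then show ?thesis using Zpos[of t] by (simp add: ln_mult)
  qed
  have "ln (Z (Suc n)) \<le> ln (card V) - \<eta> * (\<Sum>t = 1..n. \<Sum>v\<in>V. hedge \<eta> V l t v * l t v) + n * (\<eta>\<^sup>2 * M\<^sup>2)"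
    if "n \<le> T" for n
    using that
  proof (induction n)
    case 0
    show ?case by (simp add: Z_def)
  next
    case (Suc n)
    have "n \<le> T" using Suc.prems by simp
    from Suc.IH[OF this] step[of "Suc n"] Suc.prems show ?case
      by (simp add: algebra_simps)
  qed
  from this[of T] have up: "ln (Z (Suc T)) \<le> ln (card V) - \<eta> * (\<Sum>t = 1..T. \<Sum>v\<in>V. hedge \<eta> V l t v * l t v) + T * (\<eta>\<^sup>2 * M\<^sup>2)"
    by simp
  have "exp (- \<eta> * (\<Sum>s = 1..<Suc T. l s v\<^sub>0)) \<le> Z (Suc T)"
    unfolding Z_def by (rule member_le_sum[OF V(2) _ V(1)]) auto
  then have "- \<eta> * (\<Sum>s = 1..T. l s v\<^sub>0) \<le> ln (Z (Suc T))"
    using Zpos[of "Suc T"] by (simp add: ln_ge_iff atLeastLessThanSuc_atLeastAtMost)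
  with up have "\<eta> * (\<Sum>t = 1..T. \<Sum>v\<in>V. hedge \<eta> V l t v * l t v)
      \<le> \<eta> * ((\<Sum>t = 1..T. l t v\<^sub>0) + ln (card V) / \<eta> + \<eta> * T * M\<^sup>2)"
    using \<eta> by (simp add: distrib_left power2_eq_square algebra_simps)
  then show ?thesis using \<eta> by simp
qed

text \<open>One round multiplies each weight by \<open>exp (- \<eta> * l t v) / E\<close>. Numerator
  and average \<open>E\<close> both lie between \<open>exp (- \<eta> * M)\<close> and
  \<open>exp (\<eta> * M)\<close>, so all ratios are within \<open>b\<close> of 1, and the weights
  sum to 1.\<close>

lemma hedge_stability:
  fixes l :: "nat \<Rightarrow> 'v \<Rightarrow> real"
  assumes V: "finite V" "V \<noteq> {}" and \<eta>: "0 < \<eta>" "0 \<le> M" "\<eta> * M \<le> 1" and t: "1 \<le> t"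
    and l: "\<And>v. v \<in> V \<Longrightarrow> \<bar>l t v\<bar> \<le> M"
  shows "(\<Sum>v\<in>V. \<bar>hedge \<eta> V l (Suc t) v - hedge \<eta> V l t v\<bar>) \<le> 16 * (\<eta> * M)"
proof -
  define E where "E = (\<Sum>v\<in>V. hedge \<eta> V l t v * exp (- \<eta> * l t v))"
  define b where "b = exp (2 * (\<eta> * M)) - 1"
  have bd: "exp (- (\<eta> * M)) \<le> exp (- \<eta> * l t v)" "exp (- \<eta> * l t v) \<le> exp (\<eta> * M)" if "v \<in> V" for v
    using l[OF that] \<eta> by (auto simp: abs_le_iff mult_left_mono minus_le_iff)
      (smt (verit) mult_left_mono mult_minus_right)+
  have "(\<Sum>v\<in>V. hedge \<eta> V l t v * exp (- (\<eta> * M))) \<le> E"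
    unfolding E_def by (intro sum_mono mult_left_mono hedge_nonneg bd)
  then have E1: "exp (- (\<eta> * M)) \<le> E" by (simp add: sum_hedge[OF V] flip: sum_distrib_right)
  have "E \<le> (\<Sum>v\<in>V. hedge \<eta> V l t v * exp (\<eta> * M))"
    unfolding E_def by (intro sum_mono mult_left_mono hedge_nonneg bd)
  then have E2: "E \<le> exp (\<eta> * M)" by (simp add: sum_hedge[OF V] flip: sum_distrib_right)
  have Epos: "0 < E" using E1 by (smt (verit) exp_gt_zero)
  have next_eq: "hedge \<eta> V l (Suc t) v = hedge \<eta> V l t v * (exp (- \<eta> * l t v) / E)" for v
    unfolding hedge_def[of _ _ _ "Suc t"] hedge_normaliser_Suc[OF V t] E_def[symmetric]
    unfolding hedge_weight_Suc[OF t] by (simp add: hedge_def)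
  have b0: "0 \<le> b" using \<eta> by (simp add: b_def)
  have ratio: "\<bar>exp (- \<eta> * l t v) / E - 1\<bar> \<le> b" if v: "v \<in> V" for v
  proof -
    have "exp (- \<eta> * l t v) / E \<le> exp (\<eta> * M) / exp (- (\<eta> * M))"
      using bd[OF v] E1 by (intro frac_le) auto
    also have "\<dots> = 1 + b" by (simp add: b_def flip: exp_diff)
    finally have up: "exp (- \<eta> * l t v) / E \<le> 1 + b" .
    have "exp (- (\<eta> * M)) / exp (\<eta> * M) \<le> exp (- \<eta> * l t v) / E"
      using bd[OF v] E2 Epos by (intro frac_le) auto
    moreover have "exp (- (\<eta> * M)) / exp (\<eta> * M) = 1 / (1 + b)"
      by (simp add: b_def flip: exp_diff) (simp add: exp_minus field_simps)
    moreover have "1 - b \<le> 1 / (1 + b)"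
      using b0 by (simp add: field_simps)
    ultimately show ?thesis using up by linarith
  qed
  have "(\<Sum>v\<in>V. \<bar>hedge \<eta> V l (Suc t) v - hedge \<eta> V l t v\<bar>) =
    (\<Sum>v\<in>V. hedge \<eta> V l t v * \<bar>exp (- \<eta> * l t v) / E - 1\<bar>)"
    using hedge_nonneg[of \<eta> V l t]
    by (intro sum.cong refl) (simp add: next_eq abs_mult[symmetric] right_diff_distrib abs_mult_pos' flip: abs_mult)
  also have "\<dots> \<le> (\<Sum>v\<in>V. hedge \<eta> V l t v * b)"
    by (intro sum_mono mult_left_mono ratio hedge_nonneg)
  also have "\<dots> = b" by (simp add: sum_hedge[OF V] flip: sum_distrib_right)
  \<comment> \<open>From \<open>exp y \<le> 1 + 2 * y\<close> on the unit interval, squaring gives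
    \<open>b \<le> 8 * y\<close>; the constant 16 is generous.\<close>
  also have "b \<le> 16 * (\<eta> * M)"
  proof -
    define y where "y = \<eta> * M"
    have y: "0 \<le> y" "y \<le> 1" using \<eta> by (auto simp: y_def)
    have "exp y \<le> 1 + y + y\<^sup>2" using y by (intro exp_bound) auto
    also have "\<dots> \<le> 1 + 2 * y" using y by (simp add: power2_eq_square mult_left_le)
    finally have "exp y * exp y \<le> (1 + 2 * y) * (1 + 2 * y)"
      using y by (intro mult_mono) auto
    also have "\<dots> \<le> 1 + 8 * y" using y by (simp add: algebra_simps mult_left_le)
    finally have "exp (2 * y) \<le> 1 + 8 * y" by (simp add: mult_exp_exp)
    then show ?thesis using y unfolding b_def y_def by simp
  qed
  finally show ?thesis .
qed

section \<open>Gradients and causal policies\<close>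

text \<open>\<open>grad\<close> is a definite description, so existence and uniqueness are both
  needed. A linear functional on the plane is represented by its values at the two unit vectors, and
  only one vector represents it.\<close>

lemma GDERIV_grad:
  assumes "f differentiable (at y)"
  shows "GDERIV f y :> grad f y"
proof -
  obtain f' where f': "(f has_derivative f') (at y)"
    using assms by (auto simp: differentiable_def)
  interpret bounded_linear f' by (rule has_derivative_bounded_linear[OF f'])
  have "f' h = inner h (f' (1, 0), f' (0, 1))" for h
  proof -
    have "h = fst h *\<^sub>R (1, 0) + snd h *\<^sub>R (0, 1)" by (simp add: prod_eq_iff)
    then have "f' h = fst h * f' (1, 0) + snd h * f' (0, 1)"
      by (metis add scaleR real_scaleR_def)
    then show ?thesis by (simp add: inner_prod_def)
  qed
  then have 1: "GDERIV f y :> (f' (1, 0), f' (0, 1))"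
    using f' unfolding gderiv_def by (metis (no_types, lifting) ext)
  show ?thesis unfolding grad_def
  proof (rule theI[where P = "\<lambda>g. GDERIV f y :> g", OF 1])
    fix g assume "GDERIV f y :> g"
    with 1 have "(\<lambda>h. inner h g) = (\<lambda>h. inner h (f' (1, 0), f' (0, 1)))"
      unfolding gderiv_def by (rule has_derivative_unique[rotated])
    then have "inner h (g - (f' (1, 0), f' (0, 1))) = 0" for h
      by (metis inner_diff_right right_minus_eq)
    from this[of "g - (f' (1, 0), f' (0, 1))"] show "g = (f' (1, 0), f' (0, 1))" by simp
  qed
qed

lemma grad_eqI:
  assumes "GDERIV f y :> g"
  shows "grad f y = g"
proof -
  have "f differentiable (at y)"
    using assms unfolding gderiv_def differentiable_def by blast
  from GDERIV_grad[OF this] assms have "(\<lambda>h. inner h (grad f y)) = (\<lambda>h. inner h g)"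
    unfolding gderiv_def by (rule has_derivative_unique)
  then have "inner h (grad f y - g) = 0" for h
    by (metis inner_diff_right right_minus_eq)
  from this[of "grad f y - g"] show ?thesis by simp
qed

text \<open>Restriction to the line through \<open>y\<close> and \<open>z\<close> reduces this to
  the tangent inequality for convex functions of one real variable.\<close>

lemma convex_above_tangent:
  assumes "convex_differentiable f"
  shows "f y + inner (grad f y) (z - y) \<le> f z"
proof -
  define \<phi> where "\<phi> s = f (y + s *\<^sub>R (z - y))" for s :: real
  have cf: "convex_on UNIV f" and df: "f differentiable (at y)"
    using assms unfolding convex_differentiable_def by (rule conjunct1, blast)
  have "convex_on UNIV \<phi>"
  proof (rule convex_onI)
    fix t a b :: real assume "0 < t" "t < 1"
    have "y + ((1 - t) *\<^sub>R a + t *\<^sub>R b) *\<^sub>R (z - y) =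
        (1 - t) *\<^sub>R (y + a *\<^sub>R (z - y)) + t *\<^sub>R (y + b *\<^sub>R (z - y))"
      by (simp add: algebra_simps)
    then show "\<phi> ((1 - t) *\<^sub>R a + t *\<^sub>R b) \<le> (1 - t) * \<phi> a + t * \<phi> b"
      using convex_onD[OF cf, of t "y + a *\<^sub>R (z - y)" "y + b *\<^sub>R (z - y)"] \<open>0 < t\<close> \<open>t < 1\<close>
      unfolding \<phi>_def by simp
  qed simp
  moreover have "(\<phi> has_real_derivative inner (z - y) (grad f y)) (at 0)"
  proof -
    have "((\<lambda>s. y + s *\<^sub>R (z - y)) has_derivative (\<lambda>s. s *\<^sub>R (z - y))) (at 0)"
      by (auto intro!: derivative_eq_intros)
    moreover have "(f has_derivative (\<lambda>h. inner h (grad f y))) (at (y + 0 *\<^sub>R (z - y)))"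
      using GDERIV_grad[OF df] by (simp add: gderiv_def)
    ultimately have "((\<lambda>s. f (y + s *\<^sub>R (z - y))) has_derivative (\<lambda>s. inner (s *\<^sub>R (z - y)) (grad f y))) (at 0)"
      by (rule has_derivative_compose)
    then show ?thesis
      unfolding has_field_derivative_def \<phi>_def by (simp add: mult_commute_abs)
  qed
  ultimately have "\<phi> 1 - \<phi> 0 \<ge> inner (z - y) (grad f y) * (1 - 0)"
    by (intro convex_on_imp_above_tangent[of UNIV \<phi>]) auto
  then show ?thesis by (simp add: \<phi>_def inner_commute)
qed

section \<open>Strategies in terms of disturbances, realised as policies\<close>

definition causal :: "((nat \<Rightarrow> real) \<Rightarrow> (nat \<Rightarrow> cost) \<Rightarrow> (nat \<Rightarrow> real) \<Rightarrow> nat \<Rightarrow> real) \<Rightarrow> bool" where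
  "causal F \<longleftrightarrow> (\<forall>w w' c c' u u' t.
     (\<forall>s\<in>{1..<t}. w s = w' s \<and> c s = c' s \<and> u s = u' s) \<longrightarrow> F w c u t = F w' c' u' t)"

text \<open>A policy sees states and costs but neither disturbances nor its past actions. It can
  replay them: the actions are rebuilt round by round, and the disturbance of round \<open>s\<close>
  is the next state minus the rebuilt action.\<close>

primrec actions_from ::
    "((nat \<Rightarrow> real) \<Rightarrow> (nat \<Rightarrow> cost) \<Rightarrow> (nat \<Rightarrow> real) \<Rightarrow> nat \<Rightarrow> real) \<Rightarrow>
     (nat \<Rightarrow> real) \<Rightarrow> (nat \<Rightarrow> cost) \<Rightarrow> nat \<Rightarrow> nat \<Rightarrow> real" where
  "actions_from F x c 0 = (\<lambda>_. 0)"
| "actions_from F x c (Suc n) = (actions_from F x c n)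
     (Suc n := F (\<lambda>s. x (Suc s) - actions_from F x c n s) c (actions_from F x c n) (Suc n))"

lemma exists_policy_of_causal:
  assumes F: "causal F"
  shows "\<exists>p. \<forall>w c. \<forall>t\<ge>1. action p w c t = F w c (action p w c) t"
proof -
  \<comment> \<open>Lists are indexed from 0 and rounds from 1. The number of observed states is the
    current round.\<close>
  define p :: policy where
    "p xs cs = actions_from F (\<lambda>s. xs ! (s - 1)) (\<lambda>s. cs ! (s - 1)) (length xs) (length xs)" for xs cs
  \<comment> \<open>In round \<open>n\<close> there are \<open>n\<close> observed states but only
    \<open>n - 1\<close> observed costs, hence agreement of the costs is required only below
    \<open>n\<close>.\<close>
  have actions_eq: "actions_from F x c' n s = action p w c s"
    if n: "s \<in> {1..n}" and x: "\<And>s. s \<in> {1..n} \<Longrightarrow> x s = state p w c s"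
      and c: "\<And>s. s \<in> {1..<n} \<Longrightarrow> c' s = c s"
      and IH: "\<And>s. s \<in> {1..n} \<Longrightarrow> action p w c s = F w c (action p w c) s"
    for x c' w c n s
    using n x c IH
  proof (induction n arbitrary: s)
    case (Suc n)
    have IH: "actions_from F x c' n s = action p w c s" if "s \<in> {1..n}" for s
      using that Suc.prems by (intro Suc.IH) auto
    show ?case
    proof (cases "s = Suc n")
      case True
      have "F (\<lambda>s. x (Suc s) - actions_from F x c' n s) c' (actions_from F x c' n) (Suc n) =
          F w c (action p w c) (Suc n)"
      proof (rule F[unfolded causal_def, rule_format], intro conjI)
        fix s assume s: "s \<in> {1..<Suc n}"
        show "x (Suc s) - actions_from F x c' n s = w s"
          using s IH[of s] Suc.prems(2)[of "Suc s"] state_Suc[of s p w c] by simp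
        show "c' s = c s" using s Suc.prems(3) by simp
        show "actions_from F x c' n s = action p w c s" using s IH by simp
      qed
      then show ?thesis using True Suc.prems(4)[of "Suc n"] by simp
    next
      case False
      then show ?thesis using IH[of s] Suc.prems(1) by simp
    qed
  qed simp
  have "action p w c t = F w c (action p w c) t" if "1 \<le> t" for w c t
    using that
  proof (induction t rule: less_induct)
    case (less t)
    obtain n where t: "t = Suc n" using less.prems by (cases t) auto
    let ?xs = "states p w c n" and ?cs = "map c [1..<t]"
    let ?x = "\<lambda>s. ?xs ! (s - 1)" and ?c = "\<lambda>s. ?cs ! (s - 1)"
    have len: "length ?xs = Suc n" unfolding states_eq by simp
    have x: "?x s = state p w c s" if "s \<in> {1..Suc n}" for s
      using that unfolding states_eq by (auto simp del: upt_Suc simp: nth_append)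
    have c: "?c s = c s" if "s \<in> {1..n}" for s
      using that by (auto simp del: upt_Suc simp: t)
    have old: "actions_from F ?x ?c n s = action p w c s" if "s \<in> {1..n}" for s
      using that x c less.IH t by (intro actions_eq) auto
    have "action p w c t = actions_from F ?x ?c (Suc n) (Suc n)"
      using len by (simp only: action_def p_def t diff_Suc_1)
    also have "\<dots> = F (\<lambda>s. ?x (Suc s) - actions_from F ?x ?c n s) ?c (actions_from F ?x ?c n) t"
      by (simp only: actions_from.simps fun_upd_same t)
    also have "\<dots> = F w c (action p w c) t"
    proof (rule F[unfolded causal_def, rule_format], intro conjI)
      fix s assume s: "s \<in> {1..<t}"
      then have s': "s \<in> {1..n}" "Suc s \<in> {1..Suc n}" by (auto simp: t)
      show "?x (Suc s) - actions_from F ?x ?c n s = w s"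
        using old[OF s'(1)] x[OF s'(2)] state_Suc[of s p w c] s by simp
      show "?c s = c s" using c[OF s'(1)] .
      show "actions_from F ?x ?c n s = action p w c s" using old[OF s'(1)] .
    qed
    finally show ?case .
  qed
  then show ?thesis by blast
qed

section \<open>Responses and the upper bound\<close>

text \<open>Zero padding lets sums over lags run over a range that does not depend on the
  round.\<close>

definition lag :: "(nat \<Rightarrow> real) \<Rightarrow> nat \<Rightarrow> nat \<Rightarrow> real" where
  "lag w t i = (if i < t then w (t - i) else 0)"

lemma snd_trajectory:
  assumes "t \<le> Suc n"
  shows "snd (trajectory \<Phi> w t) = (\<Sum>i = 1..n. snd \<Phi> i * lag w t i)"
proof -
  have "snd (trajectory \<Phi> w t) = (\<Sum>i = 1..t - 1. snd \<Phi> i * lag w t i)"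
    by (auto simp: trajectory_def lag_def intro!: sum.cong)
  also have "\<dots> = (\<Sum>i = 1..n. snd \<Phi> i * lag w t i)"
    using assms by (intro sum.mono_neutral_left) (auto simp: lag_def)
  finally show ?thesis .
qed

text \<open>The equations \<open>fst \<Phi> 1 = 1\<close> and
  \<open>fst \<Phi> (i + 1) = snd \<Phi> i\<close> make the trajectory obey the plant, as an index
  shift in the sum shows.\<close>

lemma fst_trajectory_Suc:
  assumes "is_response \<Phi>" "1 \<le> t"
  shows "fst (trajectory \<Phi> w (Suc t)) = w t + snd (trajectory \<Phi> w t)"
proof -
  have "(\<Sum>i = 1..t. fst \<Phi> i * w (Suc t - i)) =
      fst \<Phi> 1 * w t + (\<Sum>i = Suc 1..t. fst \<Phi> i * w (Suc t - i))"
    using assms(2) by (subst sum.atLeast_Suc_atMost) auto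
  also have "(\<Sum>i = Suc 1..t. fst \<Phi> i * w (Suc t - i)) = (\<Sum>i = 1..t - 1. fst \<Phi> (Suc i) * w (t - i))"
    using assms(2) by (intro sum.reindex_bij_witness[of _ Suc "\<lambda>i. i - 1"]) auto
  also have "\<dots> = (\<Sum>i = 1..t - 1. snd \<Phi> i * w (t - i))"
    using assms(1) by (intro sum.cong) (auto simp: is_response_def)
  finally show ?thesis using assms(1) by (simp add: trajectory_def is_response_def)
qed

text \<open>The only trace of the ball in the upper bound: its control gains lie in an l1-ball,
  whose vertices serve as experts.\<close>

lemma sum_abs_le_of_response_ball:
  assumes "\<Phi> \<in> response_ball R"
  shows "(\<Sum>i = 1..n. \<bar>snd \<Phi> i\<bar>) \<le> R"
proof -
  have sm: "summable (\<lambda>i. deviation \<Phi> (Suc i))" and le: "(\<Sum>i. deviation \<Phi> (Suc i)) \<le> R"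
    using assms by (auto simp: response_ball_def)
  have dev: "\<bar>snd \<Phi> i\<bar> \<le> deviation \<Phi> i" for i
    by (simp add: deviation_def baseline_def real_le_rsqrt)
  have "(\<Sum>i = 1..n. \<bar>snd \<Phi> i\<bar>) \<le> (\<Sum>i = 1..n. deviation \<Phi> i)"
    by (intro sum_mono dev)
  also have "\<dots> = (\<Sum>i<n. deviation \<Phi> (Suc i))"
    by (intro sum.reindex_bij_witness[of _ Suc "\<lambda>i. i - 1"]) auto
  also have "\<dots> \<le> (\<Sum>i. deviation \<Phi> (Suc i))"
    using sm by (intro sum_le_suminf) (auto simp: deviation_def)
  finally show ?thesis using le by linarith
qed

lemma baseline_in_response_ball:
  assumes "0 \<le> R"
  shows "baseline \<in> response_ball R"
  using assms by (auto simp: response_ball_def is_response_def deviation_def) (auto simp: baseline_def)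

section \<open>The exponential weights controller and its regret\<close>

definition closed_loop_state :: "(nat \<Rightarrow> real) \<Rightarrow> (nat \<Rightarrow> real) \<Rightarrow> nat \<Rightarrow> real" where
  "closed_loop_state w u t = (if t \<le> 1 then 0 else u (t - 1) + w (t - 1))"

lemma state_eq_closed_loop_state:
  assumes "1 \<le> t"
  shows "state p w c t = closed_loop_state w (action p w c) t"
proof (cases "t = 1")
  case True
  then show ?thesis by (simp add: closed_loop_state_def state_def)
next
  case False
  then show ?thesis using assms state_Suc[of "t - 1" p w c] by (simp add: closed_loop_state_def)
qed

text \<open>The experts \<open>(i, \<sigma>)\<close> are the vertices \<open>\<sigma> R e\<^sub>i\<close> of the \<open>\<ell>\<^sub>1\<close>-ball of gains.\<close>

definition vertices :: "nat \<Rightarrow> (nat \<times> real) set" where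
  "vertices T = {1..T} \<times> {-1, 1}"

text \<open>Linearised cost of having always used the gain of vertex \<open>v\<close>. The state of
  round \<open>t\<close> is driven by the action of round \<open>t - 1\<close>, hence the lag at
  \<open>t - 1\<close> next to the state component of the gradient. The gradient is taken at the
  actual closed-loop point, so the losses depend on past play.\<close>

definition vertex_loss ::
    "real \<Rightarrow> (nat \<Rightarrow> real) \<Rightarrow> (nat \<Rightarrow> cost) \<Rightarrow> (nat \<Rightarrow> real) \<Rightarrow> nat \<Rightarrow> nat \<times> real \<Rightarrow> real" where
  "vertex_loss R w c u t v = (let g = grad (c t) (closed_loop_state w u t, u t) in
     snd v * R * (snd g * lag w t (fst v) + fst g * lag w (t - 1) (fst v)))"

definition hedge_action ::
    "real \<Rightarrow> nat \<Rightarrow> real \<Rightarrow> (nat \<Rightarrow> real) \<Rightarrow> (nat \<Rightarrow> cost) \<Rightarrow> (nat \<Rightarrow> real) \<Rightarrow> nat \<Rightarrow> real" where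
  "hedge_action \<eta> T R w c u t =
     (\<Sum>v\<in>vertices T. hedge \<eta> (vertices T) (vertex_loss R w c u) t v * (snd v * R * lag w t (fst v)))"

lemma finite_vertices [simp]: "finite (vertices T)"
  by (simp add: vertices_def)

text \<open>The weights of round \<open>t\<close> use only losses of earlier rounds, and since every
  vertex has lag at least 1, the features of round \<open>t\<close> use only earlier
  disturbances.\<close>

lemma causal_hedge_action: "causal (hedge_action \<eta> T R)"
  unfolding causal_def
proof (intro allI impI)
  fix w w' u u' :: "nat \<Rightarrow> real" and c c' :: "nat \<Rightarrow> cost" and t :: nat
  assume eq: "\<forall>s\<in>{1..<t}. w s = w' s \<and> c s = c' s \<and> u s = u' s"
  have lag: "lag w s i = lag w' s i" if "s \<le> t" "1 \<le> i" for s i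
    using eq[rule_format, of "s - i"] that by (auto simp: lag_def Suc_le_eq)
  have loss: "vertex_loss R w c u s v = vertex_loss R w' c' u' s v"
    if s: "s \<in> {1..<t}" and v: "v \<in> vertices T" for s v
  proof -
    have "closed_loop_state w u s = closed_loop_state w' u' s"
    proof (cases "s \<le> 1")
      case False
      then have "s - 1 \<in> {1..<t}" using s by auto
      from eq[rule_format, OF this] show ?thesis by (simp add: closed_loop_state_def)
    qed (simp add: closed_loop_state_def)
    then show ?thesis
      using eq s v lag[of s "fst v"] lag[of "s - 1" "fst v"]
      by (auto simp: vertex_loss_def vertices_def)
  qed
  have "hedge \<eta> (vertices T) (vertex_loss R w c u) t v = hedge \<eta> (vertices T) (vertex_loss R w' c' u') t v"
    if "v \<in> vertices T" for v
  proof -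
    have "(\<Sum>s = 1..<t. vertex_loss R w c u s v) = (\<Sum>s = 1..<t. vertex_loss R w' c' u' s v)"
      if "v \<in> vertices T" for v
      using that loss by (intro sum.cong refl)
    then show ?thesis using that by (simp add: hedge_def cong: sum.cong)
  qed
  then show "hedge_action \<eta> T R w c u t = hedge_action \<eta> T R w' c' u' t"
    unfolding hedge_action_def using lag[of t]
    by (intro sum.cong refl) (auto simp: vertices_def)
qed

lemma abs_weighted_sum_le:
  fixes p f :: "'v \<Rightarrow> real"
  assumes "\<And>v. v \<in> V \<Longrightarrow> \<bar>f v\<bar> \<le> B"
  shows "\<bar>\<Sum>v\<in>V. p v * f v\<bar> \<le> (\<Sum>v\<in>V. \<bar>p v\<bar>) * B"
  unfolding sum_distrib_right
  using assms by (intro order_trans[OF sum_abs] sum_mono) (simp add: abs_mult mult_left_mono)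

text \<open>Of the factor 9, one unit is the second-order term of \<open>hedge_regret\<close> and
  eight are the price of memory: the state carries the weights of round \<open>t - 1\<close>,
  whereas the loss of round \<open>t\<close> is charged with the weights of round \<open>t\<close>.
  \<open>M\<close> bounds the linearised losses, which consist of two terms of size at most
  \<open>G * D * (R * W)\<close>.\<close>

lemma hedge_controller_regret:
  fixes T :: nat and W R G D M \<eta> :: real
  assumes pos: "1 \<le> T" "0 < W" "0 < R" "0 < G" and D: "D = W * (1 + 3 * exp 1 * R)"
    and M: "M = 2 * (R * G * D * W)" and \<eta>: "0 < \<eta>" "\<eta> * M \<le> 1"
    and p: "\<And>t. 1 \<le> t \<Longrightarrow> action p w f t = hedge_action \<eta> T R w f (action p w f) t"
    and w: "\<And>t. t \<in> {1..T} \<Longrightarrow> \<bar>w t\<bar> \<le> W"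
    and f: "\<And>t. t \<in> {1..T} \<Longrightarrow> regular_cost G D (f t)"
  shows "regret T R p w f \<le> ln (real (2 * T)) / \<eta> + 9 * (\<eta> * T * M\<^sup>2)"
proof -
  let ?V = "vertices T"
  define u where "u = action p w f"
  define x where "x = state p w f"
  define g where "g t = grad (f t) (x t, u t)" for t
  define l where "l = vertex_loss R w f u"
  let ?h = "hedge \<eta> ?V l"
  define H where "H = (\<Sum>t = 1..T. \<Sum>v\<in>?V. ?h t v * l t v)"
  have D0: "0 < D" using pos by (simp add: D add_pos_pos)
  have M0: "0 \<le> M" using pos D0 by (simp add: M)
  have ne: "?V \<noteq> {}" using pos by (simp add: vertices_def)
  have sum1: "(\<Sum>v\<in>?V. ?h t v) = 1" for t by (rule sum_hedge[OF finite_vertices ne])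
  have x_eq: "x t = closed_loop_state w u t" if "1 \<le> t" for t
    using state_eq_closed_loop_state[OF that] by (simp add: x_def u_def)
  have l_eq: "l t v = snd v * R * (snd (g t) * lag w t (fst v) + fst (g t) * lag w (t - 1) (fst v))"
    if "1 \<le> t" for t v
    using x_eq[OF that] by (simp add: l_def vertex_loss_def g_def Let_def)
  have u_eq: "u t = (\<Sum>v\<in>?V. ?h t v * (snd v * R * lag w t (fst v)))" if "1 \<le> t" for t
    using p[OF that] unfolding u_def[symmetric] hedge_action_def l_def .
  have lagW: "\<bar>lag w t i\<bar> \<le> W" if "t \<le> Suc T" "1 \<le> i" for t i
    using that w[of "t - i"] pos by (auto simp: lag_def Suc_le_eq)
  have feature: "\<bar>snd v * R * lag w t (fst v)\<bar> \<le> R * W" if "t \<le> Suc T" "v \<in> ?V" for t v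
    using that lagW[of t "fst v"] pos by (auto simp: vertices_def abs_mult mult_left_mono)
  have uR: "\<bar>u t\<bar> \<le> R * W" if "t \<in> {1..T}" for t
  proof -
    have "\<bar>u t\<bar> \<le> (\<Sum>v\<in>?V. \<bar>?h t v\<bar>) * (R * W)"
      unfolding u_eq[OF conjunct1[OF that[unfolded atLeastAtMost_iff]]]
      using that by (intro abs_weighted_sum_le feature) auto
    then show ?thesis using sum1 by (simp add: hedge_nonneg)
  qed
  \<comment> \<open>The gradient bound holds only on the ball of radius \<open>D\<close>, so the
    played points must stay in it: actions are at most \<open>R * W\<close>, states at most
    \<open>R * W + W\<close>, and \<open>2 \<le> 3 * exp 1\<close>.\<close>
  have norm_y: "norm (x t, u t) \<le> D" if t: "t \<in> {1..T}" for t
  proof -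
    have "\<bar>x t\<bar> \<le> R * W + W"
    proof (cases "t = 1")
      case True
      then show ?thesis using x_eq[of t] pos by (simp add: closed_loop_state_def)
    next
      case False
      then have "t - 1 \<in> {1..T}" using t by auto
      from uR[OF this] w[OF this] show ?thesis
        using x_eq[of t] t False by (simp add: closed_loop_state_def)
    qed
    moreover have "norm (x t, u t) \<le> \<bar>x t\<bar> + \<bar>u t\<bar>"
      using norm_Pair_le[of "x t" "u t"] by simp
    moreover have "2 * (R * W) \<le> 3 * exp 1 * (R * W)"
      using pos exp_ge_add_one_self[of 1] by (intro mult_right_mono) auto
    moreover have "D = W + 3 * exp 1 * (R * W)" by (simp add: D algebra_simps)
    ultimately show ?thesis using uR[OF t] by linarith
  qed
  have g_bound: "\<bar>fst (g t)\<bar> \<le> G * D" "\<bar>snd (g t)\<bar> \<le> G * D" if t: "t \<in> {1..T}" for t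
  proof -
    have "norm (g t) \<le> G * D" using f[OF t] norm_y[OF t] by (simp add: regular_cost_def g_def)
    then show "\<bar>fst (g t)\<bar> \<le> G * D" "\<bar>snd (g t)\<bar> \<le> G * D"
      using norm_fst_le[of "fst (g t)" "snd (g t)"] norm_snd_le[of "snd (g t)" "fst (g t)"] by auto
  qed
  have l_bound: "\<bar>l t v\<bar> \<le> M" if t: "t \<in> {1..T}" and v: "v \<in> ?V" for t v
  proof -
    have "l t v = snd (g t) * (snd v * R * lag w t (fst v)) + fst (g t) * (snd v * R * lag w (t - 1) (fst v))"
      using t by (simp add: l_eq algebra_simps)
    moreover have "\<bar>snd (g t) * (snd v * R * lag w t (fst v))\<bar> \<le> G * D * (R * W)"
      using g_bound[OF t] feature[OF _ v, of t] t unfolding abs_mult[of "snd (g t)"]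
      by (intro mult_mono) auto
    moreover have "\<bar>fst (g t) * (snd v * R * lag w (t - 1) (fst v))\<bar> \<le> G * D * (R * W)"
      using g_bound[OF t] feature[OF _ v, of "t - 1"] t unfolding abs_mult[of "fst (g t)"]
      by (intro mult_mono) auto
    ultimately show ?thesis by (simp add: M mult_ac)
  qed
  define K where "K = ln (real (2 * T)) / \<eta> + \<eta> * T * M\<^sup>2"
  have card: "card ?V = 2 * T" by (simp add: vertices_def card_cartesian_product)
  have H: "H \<le> (\<Sum>t = 1..T. l t v) + K" if "v \<in> ?V" for v
  proof -
    have "H \<le> (\<Sum>t = 1..T. l t v) + ln (card ?V) / \<eta> + \<eta> * T * M\<^sup>2"
      unfolding H_def by (rule hedge_regret[OF finite_vertices that \<eta>]) (rule l_bound)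
    then show ?thesis unfolding card K_def by linarith
  qed
  have main: "(\<Sum>t = 1..T. f t (x t, u t)) - (K + 8 * (\<eta> * T * M\<^sup>2)) \<le> (\<Sum>t = 1..T. f t (trajectory \<Phi> w t))"
    if \<Phi>: "\<Phi> \<in> response_ball R" for \<Phi>
  proof -
    define a where "a = snd \<Phi>"
    have resp: "is_response \<Phi>" using \<Phi> by (simp add: response_ball_def)
    define Q where "Q i = (\<Sum>t = 1..T. snd (g t) * lag w t i + fst (g t) * lag w (t - 1) i)" for i
    \<comment> \<open>\<open>Q i\<close> is the total linearised loss of a unit gain at lag
      \<open>i\<close>. Using both signs of the vertex turns the one-sided regret bound into a bound
      on its absolute value.\<close>
    have HQ: "R * \<bar>Q i\<bar> \<le> K - H" if i: "i \<in> {1..T}" for i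
    proof -
      have v: "(i, \<sigma>) \<in> ?V" if "\<sigma> \<in> {-1, 1}" for \<sigma> using i that by (auto simp: vertices_def)
      have e: "(\<Sum>t = 1..T. l t (i, \<sigma>)) = \<sigma> * R * Q i" for \<sigma>
        unfolding Q_def sum_distrib_left by (intro sum.cong refl) (simp add: l_eq)
      have "H \<le> R * Q i + K" "H \<le> - (R * Q i) + K"
        using H[OF v[of 1]] H[OF v[of "-1"]] unfolding e by simp_all
      then have "\<bar>R * Q i\<bar> \<le> K - H" by linarith
      then show ?thesis using pos by (simp add: abs_mult)
    qed
    \<comment> \<open>The sign of \<open>K - H\<close> is needed to multiply by the bound on the
      l1-norm below.\<close>
    have "0 \<le> R * \<bar>Q 1\<bar>" using pos by simp
    also have "\<dots> \<le> K - H" using HQ[of 1] pos by simp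
    finally have KH: "0 \<le> K - H" .
    \<comment> \<open>Duality of the l1- and maximum norms extends the bound from vertices to the
      whole ball of comparators.\<close>
    have "(\<Sum>i = 1..T. a i * Q i) \<ge> - (K - H)"
    proof -
      have "- (\<Sum>i = 1..T. a i * Q i) \<le> (\<Sum>i = 1..T. \<bar>a i\<bar> * \<bar>Q i\<bar>)"
        unfolding sum_negf[symmetric] by (intro sum_mono) (simp flip: abs_mult)
      also have "\<dots> \<le> (\<Sum>i = 1..T. \<bar>a i\<bar> * ((K - H) / R))"
        using HQ pos by (intro sum_mono mult_left_mono) (auto simp: field_simps)
      also have "\<dots> \<le> R * ((K - H) / R)"
        unfolding sum_distrib_right[symmetric] a_def
        using KH pos by (intro mult_right_mono sum_abs_le_of_response_ball[OF \<Phi>]) auto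
      finally show ?thesis using pos by simp
    qed
    moreover have "(\<Sum>i = 1..T. a i * Q i) =
        (\<Sum>t = 1..T. snd (g t) * (\<Sum>i = 1..T. a i * lag w t i) + fst (g t) * (\<Sum>i = 1..T. a i * lag w (t - 1) i))"
      unfolding Q_def sum_distrib_left sum.distrib[symmetric]
      by (subst sum.swap) (intro sum.cong refl, simp add: algebra_simps)
    moreover have "f t (x t, u t) - f t (trajectory \<Phi> w t) \<le>
        (\<Sum>v\<in>?V. ?h t v * l t v) + 8 * (\<eta> * M\<^sup>2)
        - (snd (g t) * (\<Sum>i = 1..T. a i * lag w t i) + fst (g t) * (\<Sum>i = 1..T. a i * lag w (t - 1) i))"
      if t: "t \<in> {1..T}" for t
    proof -
      have t1: "1 \<le> t" using t by simp
      have tr2: "snd (trajectory \<Phi> w t) = (\<Sum>i = 1..T. a i * lag w t i)"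
        unfolding a_def using t by (intro snd_trajectory) auto
      \<comment> \<open>The disturbance of round \<open>t - 1\<close> cancels between the two
        states. For \<open>t = 1\<close> both sides vanish, because every lag at round 0 is
        0.\<close>
      have xt: "x t - fst (trajectory \<Phi> w t) =
          (\<Sum>v\<in>?V. ?h (t - 1) v * (snd v * R * lag w (t - 1) (fst v))) - (\<Sum>i = 1..T. a i * lag w (t - 1) i)"
      proof (cases "t = 1")
        case True
        then show ?thesis by (simp add: x_eq closed_loop_state_def trajectory_def lag_def)
      next
        case False
        then have t2: "1 \<le> t - 1" "t = Suc (t - 1)" using t1 by auto
        have "fst (trajectory \<Phi> w t) = w (t - 1) + (\<Sum>i = 1..T. a i * lag w (t - 1) i)"
          using fst_trajectory_Suc[OF resp t2(1), of w] snd_trajectory[of "t - 1" T \<Phi> w] t t2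
          by (simp add: a_def)
        moreover have "x t = u (t - 1) + w (t - 1)"
          using x_eq[OF t1] False t1 by (simp add: closed_loop_state_def)
        ultimately show ?thesis using u_eq[OF t2(1)] by simp
      qed
      \<comment> \<open>Replacing the old weights by the current ones costs
        \<open>G * D * (16 * (\<eta> * M) * (R * W))\<close>, and
        \<open>2 * (R * G * D * W) = M\<close> turns this into
        \<open>8 * (\<eta> * M^2)\<close>.\<close>
      have memory: "fst (g t) * (\<Sum>v\<in>?V. (?h (t - 1) v - ?h t v) * (snd v * R * lag w (t - 1) (fst v)))
          \<le> 8 * (\<eta> * M\<^sup>2)"
      proof -
        have "(\<Sum>v\<in>?V. \<bar>?h (t - 1) v - ?h t v\<bar>) \<le> 16 * (\<eta> * M)"
        proof (cases "t = 1")
          \<comment> \<open>Rounds 0 and 1 have the same empty loss history, hence equal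
            weights.\<close>
          case True
          then show ?thesis using \<eta> M0 by (simp add: hedge_def)
        next
          case False
          then have "1 \<le> t - 1" "t - 1 \<in> {1..T}" "Suc (t - 1) = t" using t by auto
          then show ?thesis
            using hedge_stability[OF finite_vertices ne \<eta>(1) M0 \<eta>(2), of "t - 1" l] l_bound[of "t - 1"]
            by (simp only: abs_minus_commute)
        qed
        then have "\<bar>\<Sum>v\<in>?V. (?h (t - 1) v - ?h t v) * (snd v * R * lag w (t - 1) (fst v))\<bar> \<le> 16 * (\<eta> * M) * (R * W)"
          using pos t by (intro order_trans[OF abs_weighted_sum_le mult_right_mono] feature) auto
        then have "\<bar>fst (g t)\<bar> * \<bar>\<Sum>v\<in>?V. (?h (t - 1) v - ?h t v) * (snd v * R * lag w (t - 1) (fst v))\<bar>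
            \<le> G * D * (16 * (\<eta> * M) * (R * W))"
          using g_bound[OF t] by (intro mult_mono) auto
        also have "\<dots> = 8 * (\<eta> * M\<^sup>2)" by (simp add: M power2_eq_square)
        finally show ?thesis unfolding abs_mult[symmetric] by linarith
      qed
      have cd: "convex_differentiable (f t)" using f[OF t] by (simp add: regular_cost_def)
      have "f t (x t, u t) - f t (trajectory \<Phi> w t) \<le> - inner (g t) (trajectory \<Phi> w t - (x t, u t))"
        using convex_above_tangent[OF cd, of "(x t, u t)" "trajectory \<Phi> w t"] by (simp add: g_def)
      also have "\<dots> = fst (g t) * (x t - fst (trajectory \<Phi> w t)) + snd (g t) * (u t - snd (trajectory \<Phi> w t))"
        by (simp add: inner_prod_def algebra_simps)
      also have "\<dots> = (\<Sum>v\<in>?V. ?h t v * l t v)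
          + fst (g t) * (\<Sum>v\<in>?V. (?h (t - 1) v - ?h t v) * (snd v * R * lag w (t - 1) (fst v)))
          - (snd (g t) * (\<Sum>i = 1..T. a i * lag w t i) + fst (g t) * (\<Sum>i = 1..T. a i * lag w (t - 1) i))"
      proof -
        define B where "B = (\<Sum>v\<in>?V. ?h t v * (snd v * R * lag w (t - 1) (fst v)))"
        have e1: "(\<Sum>v\<in>?V. ?h t v * l t v) = snd (g t) * u t + fst (g t) * B"
          unfolding l_eq[OF t1] u_eq[OF t1] B_def sum_distrib_left sum.distrib[symmetric]
          by (intro sum.cong refl) (simp add: algebra_simps)
        have e2: "(\<Sum>v\<in>?V. (?h (t - 1) v - ?h t v) * (snd v * R * lag w (t - 1) (fst v))) =
            (\<Sum>v\<in>?V. ?h (t - 1) v * (snd v * R * lag w (t - 1) (fst v))) - B"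
          unfolding B_def sum_subtractf[symmetric] left_diff_distrib ..
        show ?thesis unfolding xt tr2 e1 e2 by (simp add: right_diff_distrib)
      qed
      finally show ?thesis using memory by linarith
    qed
    then have "(\<Sum>t = 1..T. f t (x t, u t) - f t (trajectory \<Phi> w t)) \<le>
        (\<Sum>t = 1..T. (\<Sum>v\<in>?V. ?h t v * l t v) + 8 * (\<eta> * M\<^sup>2)
        - (snd (g t) * (\<Sum>i = 1..T. a i * lag w t i) + fst (g t) * (\<Sum>i = 1..T. a i * lag w (t - 1) i)))"
      by (intro sum_mono)
    ultimately show ?thesis
      by (simp add: sum_subtractf sum.distrib H_def algebra_simps)
  qed
  have "(\<Sum>t = 1..T. f t (x t, u t)) - (K + 8 * (\<eta> * T * M\<^sup>2)) \<le>
      (INF \<Phi>\<in>response_ball R. \<Sum>t = 1..T. f t (trajectory \<Phi> w t))"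
    using baseline_in_response_ball[of R] pos by (intro cINF_greatest main) auto
  then show ?thesis unfolding regret_def K_def x_def[symmetric] u_def[symmetric] by linarith
qed

lemma ln_exp_times_le:
  fixes T :: real
  assumes "1 \<le> T"
  shows "1 \<le> ln (exp 1 * T)" "ln (exp 1 * T) \<le> T"
proof -
  have "ln (exp 1 * T) = 1 + ln T" using assms by (simp add: ln_mult)
  then show "1 \<le> ln (exp 1 * T)" "ln (exp 1 * T) \<le> T"
    using assms ln_le_minus_one[of T] by auto
qed

text \<open>The rate \<open>\<eta>\<close> balances \<open>L / \<eta>\<close> against
  \<open>\<eta> * T * M^2\<close>: both equal \<open>M * sqrt (T * L)\<close>. One plus nine such
  terms with \<open>M = 2 * (R * G * D * W)\<close> give the constant 20. The argument
  \<open>exp 1 * T\<close> of the logarithm dominates the number \<open>2 * T\<close> of experts,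
  and \<open>L \<le> T\<close> ensures \<open>\<eta> * M \<le> 1\<close>.\<close>

theorem regret_upper_bound:
  assumes T: "1 \<le> T" and pos: "0 < W" "0 < R" "0 < G" and D: "D = W * (1 + 3 * exp 1 * R)"
  shows "\<exists>p. \<forall>w f. (\<forall>t\<in>{1..T}. \<bar>w t\<bar> \<le> W \<and> regular_cost G D (f t)) \<longrightarrow>
    regret T R p w f \<le> 20 * G * D * W * R * sqrt (real T * ln (exp 1 * real T))"
proof -
  define M where "M = 2 * (R * G * D * W)"
  define L where "L = ln (exp 1 * real T)"
  define \<eta> where "\<eta> = sqrt (L / T) / M"
  have D0: "0 < D" using pos by (simp add: D add_pos_pos)
  have M0: "0 < M" using pos D0 by (simp add: M_def)
  have L: "1 \<le> L" "L \<le> T" using ln_exp_times_le[of "real T"] T by (auto simp: L_def)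
  have \<eta>: "0 < \<eta>" "\<eta> * M \<le> 1"
    using L M0 T by (auto simp: \<eta>_def)
  obtain p where p: "\<And>w c t. 1 \<le> t \<Longrightarrow> action p w c t = hedge_action \<eta> T R w c (action p w c) t"
    using exists_policy_of_causal[OF causal_hedge_action] by blast
  have "regret T R p w f \<le> 20 * G * D * W * R * sqrt (real T * L)"
    if wf: "\<forall>t\<in>{1..T}. \<bar>w t\<bar> \<le> W \<and> regular_cost G D (f t)" for w f
  proof -
    have "regret T R p w f \<le> ln (real (2 * T)) / \<eta> + 9 * (\<eta> * T * M\<^sup>2)"
      using wf by (intro hedge_controller_regret[OF T pos D M_def \<eta>] p) auto
    also have "\<dots> \<le> L / \<eta> + 9 * (\<eta> * T * M\<^sup>2)"
    proof -
      have "real (2 * T) \<le> exp 1 * real T"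
        using T exp_ge_add_one_self[of 1] by (simp add: mult_right_mono)
      then have "ln (real (2 * T)) \<le> L" unfolding L_def using T by (subst ln_le_cancel_iff) auto
      then show ?thesis using \<eta> by (simp add: divide_right_mono)
    qed
    also have "L / \<eta> = M * sqrt (real T * L)"
    proof -
      have "sqrt (L / T) * sqrt (T * L) = L"
        using L T by (simp flip: real_sqrt_mult)
      then show ?thesis using L T M0 by (simp add: \<eta>_def field_simps)
    qed
    also have "\<eta> * T * M\<^sup>2 = M * sqrt (real T * L)"
    proof -
      have "sqrt (L / T) * T = sqrt (L / T * (real T * real T))" unfolding real_sqrt_mult by simp
      also have "L / T * (real T * real T) = T * L" using T by simp
      finally show ?thesis using M0 by (simp add: \<eta>_def power2_eq_square)
    qed
    finally show ?thesis by (simp add: M_def mult_ac)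
  qed
  then show ?thesis unfolding L_def by blast
qed

section \<open>Rudin-Shapiro sequences\<close>

text \<open>By Parseval this is the mean of the squared modulus over the unit circle. Working with
  coefficients keeps the flat-spectrum argument algebraic.\<close>

definition energy :: "real poly \<Rightarrow> real" where
  "energy p = (\<Sum>i\<le>degree p. (coeff p i)\<^sup>2)"

lemma energy_eq_sum:
  assumes "\<And>i. n \<le> i \<Longrightarrow> coeff p i = 0"
  shows "energy p = (\<Sum>i<n. (coeff p i)\<^sup>2)"
proof -
  have "energy p = (\<Sum>i<max n (Suc (degree p)). (coeff p i)\<^sup>2)"
    unfolding energy_def by (intro sum.mono_neutral_left) (auto simp: coeff_eq_0)
  also have "\<dots> = (\<Sum>i<n. (coeff p i)\<^sup>2)"
    using assms by (intro sum.mono_neutral_right) auto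
  finally show ?thesis .
qed

lemma sum_power2_coeff_le_energy:
  assumes "finite A"
  shows "(\<Sum>i\<in>A. (coeff p i)\<^sup>2) \<le> energy p"
proof -
  have "(\<Sum>i\<in>A. (coeff p i)\<^sup>2) = (\<Sum>i\<in>A \<inter> {..degree p}. (coeff p i)\<^sup>2)"
    using assms by (intro sum.mono_neutral_right) (auto intro: le_degree)
  also have "\<dots> \<le> energy p"
    unfolding energy_def by (intro sum_mono2) auto
  finally show ?thesis .
qed

lemma energy_monom_mult: "energy (monom 1 k * p) = energy p"
proof -
  have "energy (monom 1 k * p) = (\<Sum>i<k + Suc (degree p). (coeff (monom 1 k * p) i)\<^sup>2)"
    by (intro energy_eq_sum) (simp add: coeff_monom_mult coeff_eq_0)
  also have "\<dots> = (\<Sum>i\<in>{k..<k + Suc (degree p)}. (coeff p (i - k))\<^sup>2)"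
    by (intro sum.mono_neutral_cong_right) (auto simp: coeff_monom_mult)
  also have "\<dots> = energy p"
    unfolding energy_def by (intro sum.reindex_bij_witness[of _ "\<lambda>i. i + k" "\<lambda>i. i - k"]) auto
  finally show ?thesis .
qed

lemma energy_parallelogram: "energy (p + q) + energy (p - q) = 2 * (energy p + energy q)"
proof -
  let ?n = "Suc (max (degree p) (degree q))"
  have *: "energy (p + q) = (\<Sum>i<?n. (coeff (p + q) i)\<^sup>2)"
    "energy (p - q) = (\<Sum>i<?n. (coeff (p - q) i)\<^sup>2)"
    "energy p = (\<Sum>i<?n. (coeff p i)\<^sup>2)" "energy q = (\<Sum>i<?n. (coeff q i)\<^sup>2)"
    by (intro energy_eq_sum; simp add: coeff_eq_0)+
  show ?thesis unfolding * sum.distrib[symmetric] sum_distrib_left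
    by (intro sum.cong refl) (simp add: power2_eq_square algebra_simps)
qed

lemma energy_nonneg: "0 \<le> energy p"
  unfolding energy_def by (intro sum_nonneg) auto

primrec rudin_shapiro :: "nat \<Rightarrow> real poly \<times> real poly" where
  "rudin_shapiro 0 = (1, 1)"
| "rudin_shapiro (Suc m) = (let (p, q) = rudin_shapiro m in
     (p + monom 1 (2 ^ m) * q, p - monom 1 (2 ^ m) * q))"

text \<open>Algebraic form of the classical identity that the squared moduli of the two
  Rudin-Shapiro polynomials add up to \<open>2 * 2 ^ m\<close> on the circle. The multiplier
  \<open>a\<close> is carried along because convolution with arbitrary gains must be controlled;
  each recursion step is the parallelogram law plus shift invariance.\<close>

lemma rudin_shapiro_energy:
  "energy (a * fst (rudin_shapiro m)) + energy (a * snd (rudin_shapiro m)) = 2 * 2 ^ m * energy a"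
proof (induction m)
  case (Suc m)
  obtain p q where pq: "rudin_shapiro m = (p, q)" by fastforce
  have shift: "a * (monom 1 (2 ^ m) * q) = monom 1 (2 ^ m) * (a * q)" by (simp add: mult_ac)
  have "energy (a * fst (rudin_shapiro (Suc m))) + energy (a * snd (rudin_shapiro (Suc m))) =
      2 * (energy (a * p) + energy (a * q))"
    using energy_parallelogram[of "a * p" "monom 1 (2 ^ m) * (a * q)"]
    by (simp add: pq distrib_left right_diff_distrib shift energy_monom_mult)
  then show ?case using Suc.IH pq by simp
qed simp

lemma rudin_shapiro_coeff:
  "\<bar>coeff (fst (rudin_shapiro m)) i\<bar> = (if i < 2 ^ m then 1 else 0) \<and>
   \<bar>coeff (snd (rudin_shapiro m)) i\<bar> = (if i < 2 ^ m then 1 else 0)"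
proof (induction m arbitrary: i)
  case (Suc m)
  obtain p q where pq: "rudin_shapiro m = (p, q)" by fastforce
  have p: "\<bar>coeff p i\<bar> = (if i < 2 ^ m then 1 else 0)" and q: "\<bar>coeff q i\<bar> = (if i < 2 ^ m then 1 else 0)" for i
    using Suc.IH[of i] by (simp_all add: pq)
  have "coeff p i = 0" if "2 ^ m \<le> i" for i using p[of i] that by simp
  then show ?case
    using p[of i] q[of "i - 2 ^ m"] by (auto simp: pq coeff_monom_mult)
qed simp

text \<open>The convolution bound controls both the quadratic part of the comparator's cost and the
  autocorrelations.\<close>

lemma exists_flat_sequence:
  "\<exists>r :: nat \<Rightarrow> real. (\<forall>s. \<bar>r s\<bar> = (if s \<in> {1..2 ^ m} then 1 else 0)) \<and>
     (\<forall>a n T. (\<Sum>t = 1..T. (\<Sum>i = 1..n. a i * lag r t i)\<^sup>2) \<le> 2 * 2 ^ m * (\<Sum>i = 1..n. (a i)\<^sup>2))"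
proof -
  define P where "P = fst (rudin_shapiro m)"
  define r where "r s = (if s = 0 then 0 else coeff P (s - 1))" for s
  have "\<bar>r s\<bar> = (if s \<in> {1..2 ^ m} then 1 else 0)" for s
    using rudin_shapiro_coeff[of m "s - 1"] by (auto simp: r_def P_def)
  moreover have "(\<Sum>t = 1..T. (\<Sum>i = 1..n. a i * lag r t i)\<^sup>2) \<le> 2 * 2 ^ m * (\<Sum>i = 1..n. (a i)\<^sup>2)" for a n T
  proof -
    define A where "A = (\<Sum>i<n. monom (a (Suc i)) i)"
    have cA: "coeff A i = (if i < n then a (Suc i) else 0)" for i
      by (simp add: A_def coeff_sum sum.delta)
    \<comment> \<open>Both the sequence and the lags start at 1, so round \<open>t\<close> sees the
      coefficient of index \<open>t - 2\<close>. Round 1 is separate, since truncated subtraction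
      would wrongly give index 0.\<close>
    have conv: "(\<Sum>i = 1..n. a i * lag r t i) = (if t = 1 then 0 else coeff (A * P) (t - 2))"
      if t: "1 \<le> t" for t
    proof -
      have "(\<Sum>i = 1..n. a i * lag r t i) = (\<Sum>i<n. a (Suc i) * lag r t (Suc i))"
        by (intro sum.reindex_bij_witness[of _ Suc "\<lambda>i. i - 1"]) auto
      also have "\<dots> = (\<Sum>i\<in>{..<n} \<inter> {i. Suc i < t}. a (Suc i) * coeff P (t - 2 - i))"
        by (intro sum.mono_neutral_cong_right)
          (auto simp: lag_def r_def numeral_2_eq_2 intro!: arg_cong[where f = "coeff P"])
      also have "\<dots> = (if t = 1 then 0 else coeff (A * P) (t - 2))"
      proof (cases "t = 1")
        case False
        then have "coeff (A * P) (t - 2) = (\<Sum>i\<in>{..<n} \<inter> {i. Suc i < t}. a (Suc i) * coeff P (t - 2 - i))"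
          unfolding coeff_mult using t
          by (intro sum.mono_neutral_cong_right) (auto simp: cA)
        then show ?thesis using False by simp
      qed simp
      finally show ?thesis .
    qed
    have "(\<Sum>t = 1..T. (\<Sum>i = 1..n. a i * lag r t i)\<^sup>2) = (\<Sum>t = 1..T. (if t = 1 then 0 else coeff (A * P) (t - 2))\<^sup>2)"
      using conv by (intro sum.cong refl arg_cong[where f = "\<lambda>x. x\<^sup>2"]) simp
    also have "\<dots> = (\<Sum>t = 2..T. (coeff (A * P) (t - 2))\<^sup>2)"
      by (intro sum.mono_neutral_cong_right) auto
    also have "\<dots> = (\<Sum>i\<in>(\<lambda>t. t - 2) ` {2..T}. (coeff (A * P) i)\<^sup>2)"
      by (subst sum.reindex) (auto simp: inj_on_def)
    also have "\<dots> \<le> energy (A * P)" by (intro sum_power2_coeff_le_energy) simp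
    \<comment> \<open>The nonnegative energy of the companion polynomial is dropped.\<close>
    also have "\<dots> \<le> 2 * 2 ^ m * energy A"
      using rudin_shapiro_energy[of A m] energy_nonneg[of "A * snd (rudin_shapiro m)"] by (simp add: P_def)
    also have "energy A = (\<Sum>i<n. (coeff A i)\<^sup>2)" by (intro energy_eq_sum) (simp add: cA)
    also have "\<dots> = (\<Sum>i<n. (a (Suc i))\<^sup>2)" by (intro sum.cong) (simp_all add: cA)
    also have "\<dots> = (\<Sum>i = 1..n. (a i)\<^sup>2)"
      by (intro sum.reindex_bij_witness[of _ "\<lambda>i. i - 1" Suc]) auto
    finally show ?thesis .
  qed
  ultimately show ?thesis by blast
qed

section \<open>Softmax of random correlations\<close>

lemma sinh_ge_self:
  fixes x :: real
  assumes "0 \<le> x"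
  shows "x \<le> sinh x"
proof -
  have "sinh 0 - 0 \<le> sinh x - x"
  proof (rule DERIV_nonneg_imp_nondecreasing[OF assms])
    fix z :: real
    have "((\<lambda>x. sinh x - x) has_real_derivative cosh z - 1) (at z)"
      by (auto intro!: derivative_eq_intros)
    then show "\<exists>y. ((\<lambda>x. sinh x - x) has_real_derivative y) (at z) \<and> 0 \<le> y"
      using cosh_real_ge_1[of z] by (intro exI[of _ "cosh z - 1"]) simp
  qed
  then show ?thesis by simp
qed

lemma cosh_ge_quadratic: "1 + x\<^sup>2 / 2 \<le> cosh (x :: real)"
proof -
  have "\<bar>x / 2\<bar> \<le> \<bar>sinh (x / 2)\<bar>"
    using sinh_ge_self[of "x / 2"] sinh_ge_self[of "- (x / 2)"]
    by (cases "0 \<le> x") auto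
  then have "(x / 2)\<^sup>2 \<le> (sinh (x / 2))\<^sup>2"
    by (rule iffD1[OF abs_le_square_iff])
  then show ?thesis using cosh_double[of "x / 2"] cosh_square_eq[of "x / 2"]
    by (simp add: power2_eq_square)
qed

text \<open>Counterpart of the upper bound \<open>x^2 / 2\<close>. The two agree up to a quartic
  term, which is why the second moment of the partition function can be compared with the square of
  its mean.\<close>

lemma ln_cosh_ge:
  fixes x :: real
  assumes "x\<^sup>2 \<le> 2"
  shows "x\<^sup>2 / 2 - x ^ 4 / 4 \<le> ln (cosh x)"
proof -
  have "x\<^sup>2 / 2 - (x\<^sup>2 / 2)\<^sup>2 \<le> ln (1 + x\<^sup>2 / 2)"
    using assms by (intro ln_one_plus_pos_lower_bound) auto
  also have "\<dots> \<le> ln (cosh x)"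
    using cosh_ge_quadratic[of x] by (subst ln_le_cancel_iff) (auto simp: add_pos_nonneg)
  finally show ?thesis by (simp add: power_divide flip: power_mult)
qed

text \<open>The sub-Gaussian bound for a random sign: the logarithmic derivative of
  \<open>cosh\<close> is \<open>tanh\<close>, which stays below the identity on nonnegative
  arguments.\<close>

lemma cosh_le_exp_square: "cosh x \<le> exp ((x :: real)\<^sup>2 / 2)"
proof -
  define y where "y = \<bar>x\<bar>"
  have "0 \<le> y" by (simp add: y_def)
  have tanh: "tanh z \<le> z" if "0 \<le> z" for z :: real
  proof -
    have "0 - tanh 0 \<le> z - tanh z"
    proof (rule DERIV_nonneg_imp_nondecreasing[OF that])
      fix x :: real
      have "((\<lambda>x. x - tanh x) has_real_derivative (tanh x)\<^sup>2) (at x)"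
        by (auto intro!: derivative_eq_intros)
      then show "\<exists>y. ((\<lambda>x. x - tanh x) has_real_derivative y) (at x) \<and> 0 \<le> y"
        by (intro exI[of _ "(tanh x)\<^sup>2"]) simp
    qed
    then show ?thesis by simp
  qed
  have "0\<^sup>2 / 2 - ln (cosh 0) \<le> y\<^sup>2 / 2 - ln (cosh y)"
  proof (rule DERIV_nonneg_imp_nondecreasing[OF \<open>0 \<le> y\<close>])
    fix x :: real assume "0 \<le> x"
    have "((\<lambda>x. x\<^sup>2 / 2 - ln (cosh x)) has_real_derivative x - tanh x) (at x)"
      by (auto intro!: derivative_eq_intros simp: tanh_def)
    then show "\<exists>y. ((\<lambda>x. x\<^sup>2 / 2 - ln (cosh x)) has_real_derivative y) (at x) \<and> 0 \<le> y"
      using tanh[OF \<open>0 \<le> x\<close>] by (intro exI[of _ "x - tanh x"]) simp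
  qed
  then have "ln (cosh y) \<le> y\<^sup>2 / 2" by simp
  then have "cosh y \<le> exp (y\<^sup>2 / 2)" by (metis cosh_real_pos exp_le_cancel_iff exp_ln)
  then show ?thesis by (simp add: y_def)
qed

section \<open>Averages over independent uniform signs\<close>

definition signs :: "nat \<Rightarrow> (nat \<Rightarrow> real) set" where
  "signs T = PiE {1..T} (\<lambda>_. {-1, 1})"

definition sign_avg :: "nat \<Rightarrow> ((nat \<Rightarrow> real) \<Rightarrow> real) \<Rightarrow> real" where
  "sign_avg T f = (\<Sum>\<epsilon>\<in>signs T. f \<epsilon>) / 2 ^ T"

lemma finite_signs [simp]: "finite (signs T)"
  by (simp add: signs_def finite_PiE)

lemma card_signs: "card (signs T) = 2 ^ T"
  by (simp add: signs_def card_PiE flip: numeral_2_eq_2)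

lemma abs_sign: "\<epsilon> \<in> signs T \<Longrightarrow> t \<in> {1..T} \<Longrightarrow> \<bar>\<epsilon> t\<bar> = 1"
  unfolding signs_def by (drule PiE_mem[where x = t]) auto

lemma sign_avg_mono:
  assumes "\<And>\<epsilon>. \<epsilon> \<in> signs T \<Longrightarrow> f \<epsilon> \<le> g \<epsilon>"
  shows "sign_avg T f \<le> sign_avg T g"
  unfolding sign_avg_def using assms by (intro divide_right_mono sum_mono) auto

lemma sign_avg_add: "sign_avg T (\<lambda>\<epsilon>. f \<epsilon> + g \<epsilon>) = sign_avg T f + sign_avg T g"
  by (simp add: sign_avg_def sum.distrib add_divide_distrib)

lemma sign_avg_diff: "sign_avg T (\<lambda>\<epsilon>. f \<epsilon> - g \<epsilon>) = sign_avg T f - sign_avg T g"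
  by (simp add: sign_avg_def sum_subtractf diff_divide_distrib)

lemma sign_avg_cmult: "sign_avg T (\<lambda>\<epsilon>. c * f \<epsilon>) = c * sign_avg T f"
  by (simp add: sign_avg_def sum_distrib_left)

lemma sign_avg_divide: "sign_avg T (\<lambda>\<epsilon>. f \<epsilon> / c) = sign_avg T f / c"
  by (simp add: sign_avg_def sum_divide_distrib[symmetric])

lemma sign_avg_sum: "sign_avg T (\<lambda>\<epsilon>. \<Sum>i\<in>A. f i \<epsilon>) = (\<Sum>i\<in>A. sign_avg T (f i))"
  unfolding sign_avg_def by (subst sum.swap) (simp add: sum_divide_distrib)

lemma sign_avg_const: "sign_avg T (\<lambda>_. c) = c"
  by (simp add: sign_avg_def card_signs)

lemma sign_avg_exp: "sign_avg T (\<lambda>\<epsilon>. exp (\<Sum>t = 1..T. \<epsilon> t * b t)) = (\<Prod>t = 1..T. cosh (b t))"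
proof -
  have "(\<Sum>\<epsilon>\<in>signs T. exp (\<Sum>t = 1..T. \<epsilon> t * b t)) = (\<Sum>\<epsilon>\<in>signs T. \<Prod>t = 1..T. exp (\<epsilon> t * b t))"
    by (simp add: exp_sum)
  also have "\<dots> = (\<Prod>t = 1..T. \<Sum>y\<in>{-1, 1}. exp (y * b t))"
    unfolding signs_def by (subst prod_sum_PiE) auto
  also have "\<dots> = (\<Prod>t = 1..T. 2 * cosh (b t))"
    by (intro prod.cong refl) (simp add: cosh_field_def)
  also have "\<dots> = 2 ^ T * (\<Prod>t = 1..T. cosh (b t))" by (simp add: prod.distrib)
  finally show ?thesis by (simp add: sign_avg_def)
qed

text \<open>Flipping coordinate \<open>t\<close> is an involution of the sign vectors that negates
  the summand.\<close>

lemma sign_avg_mult_independent: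
  assumes t: "t \<in> {1..T}" and f: "\<And>\<epsilon>. \<epsilon> \<in> signs T \<Longrightarrow> f (\<epsilon>(t := - \<epsilon> t)) = f \<epsilon>"
  shows "sign_avg T (\<lambda>\<epsilon>. \<epsilon> t * f \<epsilon>) = 0"
proof -
  have mem: "\<epsilon>(t := - \<epsilon> t) \<in> signs T" if "\<epsilon> \<in> signs T" for \<epsilon>
    using that t abs_sign[OF that t] by (auto simp: signs_def PiE_iff extensional_def)
  have "(\<Sum>\<epsilon>\<in>signs T. \<epsilon> t * f \<epsilon>) = (\<Sum>\<epsilon>\<in>signs T. - \<epsilon> t * f \<epsilon>)"
    by (rule sum.reindex_bij_witness[of _ "\<lambda>\<epsilon>. \<epsilon>(t := - \<epsilon> t)" "\<lambda>\<epsilon>. \<epsilon>(t := - \<epsilon> t)"])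
      (use mem f in auto)
  then show ?thesis by (simp add: sign_avg_def sum_negf)
qed

text \<open>\<open>2 * N \<le> T\<close> ensures that each of the shifts \<open>1..N\<close> of the
  block lies inside the horizon, so all correlations have the same variance
  \<open>N\<close>.\<close>

locale flat_sequence =
  fixes N T :: nat and r :: "nat \<Rightarrow> real"
  assumes N: "1 \<le> N" "2 * N \<le> T"
    and abs_r: "\<bar>r s\<bar> = (if s \<in> {1..N} then 1 else 0)"
    and flat: "(\<Sum>t = 1..n. (\<Sum>i = 1..k. a i * lag r t i)\<^sup>2) \<le> 2 * real N * (\<Sum>i = 1..k. (a i)\<^sup>2)"
begin

definition corr :: "(nat \<Rightarrow> real) \<Rightarrow> nat \<Rightarrow> real" where
  "corr \<epsilon> i = (\<Sum>t = 1..T. \<epsilon> t * lag r t i)"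

definition autocorr :: "nat \<Rightarrow> nat \<Rightarrow> real" where
  "autocorr i j = (\<Sum>t = 1..T. lag r t i * lag r t j)"

lemma abs_lag: "\<bar>lag r t i\<bar> = (if t \<in> {i + 1..i + N} then 1 else 0)"
  using abs_r[of "t - i"] by (auto simp: lag_def)

lemma lag_power2: "(lag r t i)\<^sup>2 = (if t \<in> {i + 1..i + N} then 1 else 0)"
  using abs_lag[of t i] by (auto simp: abs_if split: if_splits)

lemma support_subset: "i \<in> {1..N} \<Longrightarrow> {i + 1..i + N} \<subseteq> {1..T}"
  using N by auto

lemma sum_lag_power2:
  assumes "i \<in> {1..N}"
  shows "(\<Sum>t = 1..T. (lag r t i)\<^sup>2) = N"
proof -
  have "(\<Sum>t = 1..T. (lag r t i)\<^sup>2) = (\<Sum>t\<in>{i + 1..i + N}. 1)"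
    using support_subset[OF assms] by (intro sum.mono_neutral_cong_right) (auto simp: lag_power2)
  then show ?thesis by simp
qed

lemma abs_autocorr_le:
  assumes i: "i \<in> {1..N}" and j: "j \<in> {1..N}"
  shows "\<bar>autocorr i j\<bar> \<le> N"
proof -
  have "(autocorr i j)\<^sup>2 \<le> real N * real N"
    unfolding autocorr_def
    using Cauchy_Schwarz_ineq_sum[of "\<lambda>t. lag r t i" "\<lambda>t. lag r t j" "{1..T}"]
    by (simp only: sum_lag_power2[OF i] sum_lag_power2[OF j])
  then show ?thesis
    using abs_le_square_iff[of "autocorr i j" "real N"] by (simp add: power2_eq_square)
qed

text \<open>The bound \<open>flat\<close> applied to the adjoint of the convolution operator.\<close>

lemma sum_autocorr_power2:
  assumes i: "i \<in> {1..N}"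
  shows "(\<Sum>j = 1..N. (autocorr i j)\<^sup>2) \<le> 2 * (real N)\<^sup>2"
proof -
  define S where "S = (\<Sum>j = 1..N. (autocorr i j)\<^sup>2)"
  have "S = (\<Sum>t = 1..T. lag r t i * (\<Sum>j = 1..N. autocorr i j * lag r t j))"
  proof -
    have "S = (\<Sum>j = 1..N. \<Sum>t = 1..T. lag r t i * (autocorr i j * lag r t j))"
      unfolding S_def power2_eq_square
      by (intro sum.cong refl) (simp add: autocorr_def sum_distrib_left mult_ac)
    then show ?thesis by (subst (asm) sum.swap) (simp add: sum_distrib_left)
  qed
  then have "S\<^sup>2 = (\<Sum>t = 1..T. lag r t i * (\<Sum>j = 1..N. autocorr i j * lag r t j))\<^sup>2"
    by (rule arg_cong)
  also have "\<dots> \<le> (\<Sum>t = 1..T. (lag r t i)\<^sup>2) * (\<Sum>t = 1..T. (\<Sum>j = 1..N. autocorr i j * lag r t j)\<^sup>2)"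
    by (rule Cauchy_Schwarz_ineq_sum)
  also have "\<dots> \<le> real N * (2 * real N * S)"
    unfolding sum_lag_power2[OF i] S_def by (intro mult_left_mono flat) auto
  finally have "S * S \<le> (2 * (real N)\<^sup>2) * S" by (simp add: power2_eq_square mult_ac)
  moreover have "0 \<le> S" unfolding S_def by (intro sum_nonneg) auto
  ultimately show ?thesis unfolding S_def[symmetric]
    by (metis dual_order.order_iff_strict mult_le_cancel_right_pos zero_le_mult_iff zero_le_numeral zero_le_power2)
qed

text \<open>Cauchy-Schwarz turns the l2-bound on a row of autocorrelations into an l1-bound of order
  \<open>N * sqrt N\<close>, against the trivial \<open>N^2\<close>. This saving makes the second
  moment method work.\<close>

lemma sum_abs_autocorr:
  assumes i: "i \<in> {1..N}"
  shows "(\<Sum>j = 1..N. \<bar>autocorr i j\<bar>) \<le> N * sqrt (2 * real N)"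
proof -
  have "(\<Sum>j = 1..N. 1 * \<bar>autocorr i j\<bar>)\<^sup>2 \<le> (\<Sum>j = 1..N. 1\<^sup>2) * (\<Sum>j = 1..N. \<bar>autocorr i j\<bar>\<^sup>2)"
    by (rule Cauchy_Schwarz_ineq_sum)
  also have "\<dots> \<le> N * (2 * (real N)\<^sup>2)"
    using mult_left_mono[OF sum_autocorr_power2[OF i], of "real N"] by simp
  also have "\<dots> = (N * sqrt (2 * real N))\<^sup>2" unfolding power_mult_distrib by (simp add: power2_eq_square)
  finally have "(\<Sum>j = 1..N. 1 * \<bar>autocorr i j\<bar>) \<le> N * sqrt (2 * real N)"
    by (rule power2_le_imp_le) simp
  then show ?thesis by simp
qed

lemma exp_eta_corr: "exp (\<eta> * corr \<epsilon> i) = exp (\<Sum>t = 1..T. \<epsilon> t * (\<eta> * lag r t i))"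
  unfolding corr_def sum_distrib_left by (intro arg_cong[where f = exp] sum.cong) auto

lemma sign_avg_exp_corr:
  assumes i: "i \<in> {1..N}"
  shows "sign_avg T (\<lambda>\<epsilon>. exp (\<eta> * corr \<epsilon> i)) = cosh \<eta> ^ N"
proof -
  have "(\<Prod>t = 1..T. cosh (\<eta> * lag r t i)) = (\<Prod>t\<in>{i + 1..i + N}. cosh \<eta>)"
  proof (rule prod.mono_neutral_cong_right)
    show "\<forall>t\<in>{1..T} - {i + 1..i + N}. cosh (\<eta> * lag r t i) = 1"
    proof
      fix t assume "t \<in> {1..T} - {i + 1..i + N}"
      then have "lag r t i = 0" using abs_lag[of t i] by (auto split: if_splits)
      then show "cosh (\<eta> * lag r t i) = 1" by simp
    qed
    show "cosh (\<eta> * lag r t i) = cosh \<eta>" if "t \<in> {i + 1..i + N}" for t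
      using abs_lag[of t i] that cosh_real_abs[of "\<eta> * lag r t i"] by (simp add: abs_mult)
  qed (use support_subset[OF i] in auto)
  then show ?thesis unfolding exp_eta_corr sign_avg_exp by simp
qed

lemma sign_avg_exp_corr_corr:
  assumes i: "i \<in> {1..N}" and j: "j \<in> {1..N}"
  shows "sign_avg T (\<lambda>\<epsilon>. exp (\<eta> * corr \<epsilon> i) * exp (\<eta> * corr \<epsilon> j)) \<le> exp (\<eta>\<^sup>2 * (N + autocorr i j))"
proof -
  have "exp (\<eta> * corr \<epsilon> i) * exp (\<eta> * corr \<epsilon> j) = exp (\<Sum>t = 1..T. \<epsilon> t * (\<eta> * (lag r t i + lag r t j)))" for \<epsilon>
    unfolding exp_eta_corr exp_add[symmetric] sum.distrib[symmetric]
    by (intro arg_cong[where f = exp] sum.cong) (auto simp: algebra_simps)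
  then have "sign_avg T (\<lambda>\<epsilon>. exp (\<eta> * corr \<epsilon> i) * exp (\<eta> * corr \<epsilon> j)) =
      (\<Prod>t = 1..T. cosh (\<eta> * (lag r t i + lag r t j)))"
    by (simp only: sign_avg_exp)
  also have "\<dots> \<le> (\<Prod>t = 1..T. exp ((\<eta> * (lag r t i + lag r t j))\<^sup>2 / 2))"
    by (intro prod_mono) (auto simp: cosh_le_exp_square)
  also have "\<dots> = exp (\<Sum>t = 1..T. (\<eta> * (lag r t i + lag r t j))\<^sup>2 / 2)" by (simp add: exp_sum)
  also have "(\<Sum>t = 1..T. (\<eta> * (lag r t i + lag r t j))\<^sup>2 / 2) =
      \<eta>\<^sup>2 / 2 * ((\<Sum>t = 1..T. (lag r t i)\<^sup>2) + (\<Sum>t = 1..T. (lag r t j)\<^sup>2) + 2 * autocorr i j)"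
    unfolding autocorr_def sum.distrib[symmetric] sum_distrib_left
    by (intro sum.cong refl) (simp add: power2_eq_square algebra_simps)
  also have "\<dots> = \<eta>\<^sup>2 * (N + autocorr i j)"
    unfolding sum_lag_power2[OF i] sum_lag_power2[OF j] by (simp add: algebra_simps)
  finally show ?thesis .
qed

section \<open>The partition function and its second moment\<close>

definition partition_fn :: "real \<Rightarrow> (nat \<Rightarrow> real) \<Rightarrow> real" where
  "partition_fn \<eta> \<epsilon> = (\<Sum>i = 1..N. exp (\<eta> * corr \<epsilon> i))"

definition softmax :: "real \<Rightarrow> (nat \<Rightarrow> real) \<Rightarrow> nat \<Rightarrow> real" where
  "softmax \<eta> \<epsilon> i = exp (\<eta> * corr \<epsilon> i) / partition_fn \<eta> \<epsilon>"

lemma partition_fn_pos: "0 < partition_fn \<eta> \<epsilon>"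
  unfolding partition_fn_def using N by (intro sum_pos) auto

lemma softmax_pos: "0 < softmax \<eta> \<epsilon> i"
  by (simp add: softmax_def partition_fn_pos)

lemma sum_softmax: "(\<Sum>i = 1..N. softmax \<eta> \<epsilon> i) = 1"
  using partition_fn_pos[of \<eta> \<epsilon>]
  by (simp add: softmax_def partition_fn_def flip: sum_divide_distrib)

text \<open>Gibbs' variational principle: the difference of the two sides is the relative entropy of
  the softmax with respect to the uniform distribution. Its nonnegativity is proved termwise from
  \<open>ln x \<le> x - 1\<close>.\<close>

lemma ln_partition_fn_le: "ln (partition_fn \<eta> \<epsilon> / N) \<le> \<eta> * (\<Sum>i = 1..N. softmax \<eta> \<epsilon> i * corr \<epsilon> i)"
proof -
  let ?p = "softmax \<eta> \<epsilon>" and ?E = "partition_fn \<eta> \<epsilon>"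
  have N0: "0 < real N" using N by simp
  have "?p i - 1 / N \<le> ?p i * (\<eta> * corr \<epsilon> i - ln (?E / N))" for i
  proof -
    have "ln (1 / (?p i * N)) \<le> 1 / (?p i * N) - 1"
      using softmax_pos[of \<eta> \<epsilon> i] N0 by (intro ln_le_minus_one) simp
    moreover have "ln (1 / (?p i * N)) = - (\<eta> * corr \<epsilon> i - ln (?E / N))"
      using partition_fn_pos[of \<eta> \<epsilon>] N0 by (simp add: softmax_def ln_div ln_mult)
    ultimately have "1 - 1 / (?p i * N) \<le> \<eta> * corr \<epsilon> i - ln (?E / N)" by linarith
    then have "?p i * (1 - 1 / (?p i * N)) \<le> ?p i * (\<eta> * corr \<epsilon> i - ln (?E / N))"
      using softmax_pos[of \<eta> \<epsilon> i] by (intro mult_left_mono) auto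
    moreover have "?p i * (1 - 1 / (?p i * N)) = ?p i - 1 / N"
      using softmax_pos[of \<eta> \<epsilon> i] N0 by (simp add: right_diff_distrib)
    ultimately show ?thesis by simp
  qed
  then have "(\<Sum>i = 1..N. ?p i - 1 / N) \<le> (\<Sum>i = 1..N. ?p i * (\<eta> * corr \<epsilon> i - ln (?E / N)))"
    by (intro sum_mono)
  moreover have "(\<Sum>i = 1..N. ?p i - 1 / N) = 0"
    using N0 by (simp add: sum_subtractf sum_softmax[simplified])
  moreover have "(\<Sum>i = 1..N. ?p i * (\<eta> * corr \<epsilon> i - ln (?E / N))) =
      \<eta> * (\<Sum>i = 1..N. ?p i * corr \<epsilon> i) - (\<Sum>i = 1..N. ?p i) * ln (?E / N)"
    unfolding sum_distrib_left sum_distrib_right sum_subtractf[symmetric]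
    by (intro sum.cong refl) (simp add: algebra_simps)
  ultimately show ?thesis by (simp add: sum_softmax[simplified])
qed

definition normalised_partition_fn :: "real \<Rightarrow> (nat \<Rightarrow> real) \<Rightarrow> real" where
  "normalised_partition_fn \<eta> \<epsilon> = partition_fn \<eta> \<epsilon> / (N * cosh \<eta> ^ N)"

lemma sign_avg_normalised_partition_fn: "sign_avg T (normalised_partition_fn \<eta>) = 1"
proof -
  have "sign_avg T (partition_fn \<eta>) = (\<Sum>i = 1..N. cosh \<eta> ^ N)"
    unfolding partition_fn_def sign_avg_sum by (intro sum.cong refl sign_avg_exp_corr)
  then show ?thesis
    using N unfolding normalised_partition_fn_def sign_avg_divide by simp
qed

lemma cosh_power_ge:
  fixes \<eta> :: real
  assumes "\<eta>\<^sup>2 \<le> 2"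
  shows "exp (N * (\<eta>\<^sup>2 / 2 - \<eta> ^ 4 / 4)) \<le> cosh \<eta> ^ N"
proof -
  have "exp (\<eta>\<^sup>2 / 2 - \<eta> ^ 4 / 4) \<le> exp (ln (cosh \<eta>))"
    using ln_cosh_ge[OF assms] by (simp only: exp_le_cancel_iff)
  then have "exp (\<eta>\<^sup>2 / 2 - \<eta> ^ 4 / 4) ^ N \<le> cosh \<eta> ^ N" by (intro power_mono) simp_all
  then show ?thesis by (simp add: exp_of_nat_mult)
qed

text \<open>The normalised mean is 1, so this bounds the variance. The pair \<open>(i, j)\<close>
  contributes \<open>exp (\<eta>^2 * autocorr i j)\<close> relative to independent shifts, and the
  row sums of the autocorrelations are small.\<close>

lemma sign_avg_normalised_partition_fn_power2:
  fixes \<eta> :: real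
  assumes \<eta>: "\<eta>\<^sup>2 \<le> 2"
  shows "sign_avg T (\<lambda>\<epsilon>. (normalised_partition_fn \<eta> \<epsilon>)\<^sup>2)
    \<le> exp (N * \<eta> ^ 4 / 2) * (1 + \<eta>\<^sup>2 * sqrt (2 * real N) * exp (\<eta>\<^sup>2 * N))"
proof -
  define q where "q = \<eta>\<^sup>2 * exp (\<eta>\<^sup>2 * N)"
  have N0: "0 < real N" using N by simp
  have q0: "0 \<le> q" by (simp add: q_def)
  \<comment> \<open>Linearising the exponential makes the bound on row sums applicable. The
    remaining exponent is bounded by its worst case, the diagonal value \<open>N\<close>.\<close>
  have exp_le: "exp (\<eta>\<^sup>2 * autocorr i j) \<le> 1 + q * \<bar>autocorr i j\<bar>" if "i \<in> {1..N}" "j \<in> {1..N}" for i j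
  proof -
    define x where "x = \<eta>\<^sup>2 * autocorr i j"
    have "exp x * (1 + (- x)) \<le> exp x * exp (- x)"
      by (intro mult_left_mono exp_ge_add_one_self) simp
    then have "exp x \<le> 1 + x * exp x" by (simp add: algebra_simps flip: exp_add)
    also have "x * exp x \<le> \<bar>x\<bar> * exp (\<eta>\<^sup>2 * N)"
      using abs_autocorr_le[OF that] by (intro mult_mono) (auto simp: x_def intro!: mult_left_mono)
    finally show ?thesis by (simp add: x_def q_def abs_mult mult_ac)
  qed
  have "sign_avg T (\<lambda>\<epsilon>. (partition_fn \<eta> \<epsilon>)\<^sup>2) =
      (\<Sum>i = 1..N. \<Sum>j = 1..N. sign_avg T (\<lambda>\<epsilon>. exp (\<eta> * corr \<epsilon> i) * exp (\<eta> * corr \<epsilon> j)))"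
    unfolding partition_fn_def power2_eq_square sum_product sign_avg_sum ..
  also have "\<dots> \<le> (\<Sum>i = 1..N. \<Sum>j = 1..N. exp (\<eta>\<^sup>2 * N) * (1 + q * \<bar>autocorr i j\<bar>))"
  proof (intro sum_mono)
    fix i j assume ij: "i \<in> {1..N}" "j \<in> {1..N}"
    have "sign_avg T (\<lambda>\<epsilon>. exp (\<eta> * corr \<epsilon> i) * exp (\<eta> * corr \<epsilon> j)) \<le> exp (\<eta>\<^sup>2 * N) * exp (\<eta>\<^sup>2 * autocorr i j)"
      using sign_avg_exp_corr_corr[OF ij] by (simp add: distrib_left exp_add)
    also have "\<dots> \<le> exp (\<eta>\<^sup>2 * N) * (1 + q * \<bar>autocorr i j\<bar>)"
      by (intro mult_left_mono exp_le ij) simp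
    finally show "sign_avg T (\<lambda>\<epsilon>. exp (\<eta> * corr \<epsilon> i) * exp (\<eta> * corr \<epsilon> j)) \<le> exp (\<eta>\<^sup>2 * N) * (1 + q * \<bar>autocorr i j\<bar>)" .
  qed
  also have "\<dots> = (\<Sum>i = 1..N. exp (\<eta>\<^sup>2 * N) * (N + q * (\<Sum>j = 1..N. \<bar>autocorr i j\<bar>)))"
    by (simp add: sum.distrib sum_distrib_left[symmetric])
  also have "\<dots> \<le> (\<Sum>i = 1..N. exp (\<eta>\<^sup>2 * N) * (N + q * (N * sqrt (2 * real N))))"
    by (intro sum_mono mult_left_mono add_left_mono sum_abs_autocorr q0) auto
  also have "\<dots> = exp (\<eta>\<^sup>2 * N) * ((real N)\<^sup>2 * (1 + q * sqrt (2 * real N)))"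
    by (simp add: power2_eq_square algebra_simps)
  finally have le: "sign_avg T (\<lambda>\<epsilon>. (partition_fn \<eta> \<epsilon>)\<^sup>2) \<le> exp (\<eta>\<^sup>2 * N) * ((real N)\<^sup>2 * (1 + q * sqrt (2 * real N)))" .
  \<comment> \<open>The factor \<open>exp (N * \<eta> ^ 4 / 2)\<close> is the loss in passing from
    \<open>exp (\<eta>^2 * N)\<close> to the squared mean
    \<open>(cosh \<eta> ^ N)^2\<close>.\<close>
  have "exp (N * (\<eta>\<^sup>2 / 2 - \<eta> ^ 4 / 4)) * exp (N * (\<eta>\<^sup>2 / 2 - \<eta> ^ 4 / 4)) \<le> cosh \<eta> ^ N * cosh \<eta> ^ N"
    using cosh_power_ge[OF \<eta>] by (intro mult_mono) auto
  then have "exp (N * \<eta> ^ 4 / 2) * exp (N * (\<eta>\<^sup>2 - \<eta> ^ 4 / 2)) \<le> exp (N * \<eta> ^ 4 / 2) * (cosh \<eta> ^ N)\<^sup>2"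
    by (intro mult_left_mono) (simp_all add: power2_eq_square algebra_simps flip: exp_add)
  then have c: "exp (\<eta>\<^sup>2 * N) \<le> exp (N * \<eta> ^ 4 / 2) * (cosh \<eta> ^ N)\<^sup>2"
    by (simp add: algebra_simps flip: exp_add)
  have "sign_avg T (\<lambda>\<epsilon>. (normalised_partition_fn \<eta> \<epsilon>)\<^sup>2) =
      sign_avg T (\<lambda>\<epsilon>. (partition_fn \<eta> \<epsilon>)\<^sup>2) / ((real N)\<^sup>2 * (cosh \<eta> ^ N)\<^sup>2)"
    unfolding normalised_partition_fn_def power_divide power_mult_distrib sign_avg_divide ..
  also have "\<dots> \<le> (exp (N * \<eta> ^ 4 / 2) * (cosh \<eta> ^ N)\<^sup>2) * ((real N)\<^sup>2 * (1 + q * sqrt (2 * real N))) / ((real N)\<^sup>2 * (cosh \<eta> ^ N)\<^sup>2)"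
    using q0 by (intro divide_right_mono order_trans[OF le] mult_right_mono[OF c]) auto
  also have "\<dots> = exp (N * \<eta> ^ 4 / 2) * (1 + q * sqrt (2 * real N))"
    using N0 by (simp add: field_simps)
  finally show ?thesis by (simp add: q_def mult_ac)
qed

text \<open>The weights are the softmax where the normalised partition function is at least 1/2, and
  zero elsewhere; the zero comparator neither gains nor pays. The truncation also bounds the
  partition function from below, which the estimate of the squared weights requires. The threshold
  1/2 is the source of \<open>ln 2\<close> in \<open>B\<close>.\<close>

theorem exists_weights:
  fixes \<eta> B :: real
  assumes \<eta>: "0 < \<eta>" "\<eta>\<^sup>2 \<le> 2"
    and var: "exp (N * \<eta> ^ 4 / 2) * (1 + \<eta>\<^sup>2 * sqrt (2 * real N) * exp (\<eta>\<^sup>2 * N)) \<le> 9 / 8"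
    and B: "B = N * (\<eta>\<^sup>2 / 2 - \<eta> ^ 4 / 4) - ln 2" "0 \<le> B"
  shows "\<exists>p :: (nat \<Rightarrow> real) \<Rightarrow> nat \<Rightarrow> real. (\<forall>\<epsilon> i. 0 \<le> p \<epsilon> i) \<and> (\<forall>\<epsilon>. (\<Sum>i = 1..N. p \<epsilon> i) \<le> 1) \<and>
    B / (8 * \<eta>) - exp (2 * \<eta>\<^sup>2 * N) / 2 \<le>
    sign_avg T (\<lambda>\<epsilon>. (\<Sum>i = 1..N. p \<epsilon> i * corr \<epsilon> i) / 4 - N * (\<Sum>i = 1..N. (p \<epsilon> i)\<^sup>2) / 8)"
proof -
  let ?Z = "normalised_partition_fn \<eta>"
  define p where "p \<epsilon> i = (if 1 / 2 \<le> ?Z \<epsilon> then softmax \<eta> \<epsilon> i else 0)" for \<epsilon> i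
  have N0: "0 < real N" using N by simp
  have p0: "0 \<le> p \<epsilon> i" for \<epsilon> i using softmax_pos[of \<eta> \<epsilon> i] by (simp add: p_def)
  have p1: "(\<Sum>i = 1..N. p \<epsilon> i) \<le> 1" for \<epsilon>
    by (cases "1 / 2 \<le> ?Z \<epsilon>") (simp_all add: p_def sum_softmax[simplified])
  \<comment> \<open>Chebyshev's inequality in pointwise form: \<open>1 - 4 * (Z - 1)^2\<close> is at
    most 1, and it is not positive once \<open>Z\<close> falls below 1/2.\<close>
  have gain: "B / \<eta> * (1 - 4 * (?Z \<epsilon> - 1)\<^sup>2) \<le> (\<Sum>i = 1..N. p \<epsilon> i * corr \<epsilon> i)" for \<epsilon>
  proof (cases "1 / 2 \<le> ?Z \<epsilon>")
    case True
    have "exp B = exp (N * (\<eta>\<^sup>2 / 2 - \<eta> ^ 4 / 4)) / 2"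
      unfolding B(1) exp_diff by simp
    also have "\<dots> \<le> cosh \<eta> ^ N / 2" using cosh_power_ge[OF \<eta>(2)] by simp
    also have "\<dots> \<le> cosh \<eta> ^ N * ?Z \<epsilon>" using mult_left_mono[OF True, of "cosh \<eta> ^ N"] by simp
    also have "\<dots> = partition_fn \<eta> \<epsilon> / N" by (simp add: normalised_partition_fn_def)
    finally have "B \<le> ln (partition_fn \<eta> \<epsilon> / N)"
      using partition_fn_pos[of \<eta> \<epsilon>] N0 by (simp add: ln_ge_iff)
    also note ln_partition_fn_le
    finally have "B / \<eta> \<le> (\<Sum>i = 1..N. softmax \<eta> \<epsilon> i * corr \<epsilon> i)"
      using \<eta> by (simp add: pos_divide_le_eq mult.commute)
    moreover have "B / \<eta> * (1 - 4 * (?Z \<epsilon> - 1)\<^sup>2) \<le> B / \<eta> * 1"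
      using B \<eta> by (intro mult_left_mono) auto
    ultimately show ?thesis using True by (simp add: p_def)
  next
    case False
    then have "(1 / 2)\<^sup>2 \<le> (1 - ?Z \<epsilon>)\<^sup>2" by (intro power_mono) auto
    then have "1 - 4 * (?Z \<epsilon> - 1)\<^sup>2 \<le> 0" by (simp add: power2_commute power_divide)
    then have "B / \<eta> * (1 - 4 * (?Z \<epsilon> - 1)\<^sup>2) \<le> 0"
      using B \<eta> by (intro mult_nonneg_nonpos) auto
    then show ?thesis using False by (simp add: p_def)
  qed
  \<comment> \<open>On the event the partition function is at least \<open>N / 2\<close>. Squaring
    doubles the inverse temperature, so the average is again an exponential moment, now at
    \<open>2 * \<eta>\<close>.\<close>
  have pen: "(p \<epsilon> i)\<^sup>2 \<le> 4 / (real N)\<^sup>2 * exp ((2 * \<eta>) * corr \<epsilon> i)" for \<epsilon> i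
  proof (cases "1 / 2 \<le> ?Z \<epsilon>")
    case True
    have "1 \<le> cosh \<eta> ^ N" using cosh_real_ge_1 by (rule one_le_power)
    then have "real N / 2 \<le> N * cosh \<eta> ^ N * (1 / 2)" using mult_left_mono[of 1 "cosh \<eta> ^ N" "real N"] by simp
    also have "\<dots> \<le> N * cosh \<eta> ^ N * ?Z \<epsilon>" by (intro mult_left_mono True) simp
    also have "\<dots> = partition_fn \<eta> \<epsilon>" using N0 by (simp add: normalised_partition_fn_def)
    finally have "exp (\<eta> * corr \<epsilon> i) / partition_fn \<eta> \<epsilon> \<le> exp (\<eta> * corr \<epsilon> i) / (N / 2)"
      using N0 by (intro divide_left_mono) (auto simp: partition_fn_pos)
    then have "(p \<epsilon> i)\<^sup>2 \<le> (exp (\<eta> * corr \<epsilon> i) / (N / 2))\<^sup>2"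
      using True partition_fn_pos[of \<eta> \<epsilon>] by (intro power_mono) (auto simp: p_def softmax_def)
    also have "\<dots> = 4 / (real N)\<^sup>2 * exp ((2 * \<eta>) * corr \<epsilon> i)"
      by (simp add: power_divide power2_eq_square mult.assoc flip: exp_add)
    finally show ?thesis .
  next
    case False
    then show ?thesis by (simp add: p_def)
  qed
  have "sign_avg T (\<lambda>\<epsilon>. (?Z \<epsilon> - 1)\<^sup>2) = sign_avg T (\<lambda>\<epsilon>. (?Z \<epsilon>)\<^sup>2 - 2 * ?Z \<epsilon> + 1)"
    by (simp add: power2_eq_square algebra_simps)
  also have "\<dots> = sign_avg T (\<lambda>\<epsilon>. (?Z \<epsilon>)\<^sup>2) - 1"
    unfolding sign_avg_add sign_avg_diff sign_avg_cmult sign_avg_const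
    by (simp add: sign_avg_normalised_partition_fn[simplified])
  also have "\<dots> \<le> 1 / 8"
    using order_trans[OF sign_avg_normalised_partition_fn_power2[OF \<eta>(2)] var] by simp
  \<comment> \<open>The bound \<open>9 / 8\<close> on the second moment means variance at most 1/8,
    so half of \<open>B / \<eta>\<close> survives.\<close>
  finally have "1 / 2 \<le> 1 - 4 * sign_avg T (\<lambda>\<epsilon>. (?Z \<epsilon> - 1)\<^sup>2)" by simp
  then have "B / \<eta> * (1 / 2) \<le> B / \<eta> * (1 - 4 * sign_avg T (\<lambda>\<epsilon>. (?Z \<epsilon> - 1)\<^sup>2))"
    using B \<eta> by (intro mult_left_mono) auto
  also have "\<dots> = sign_avg T (\<lambda>\<epsilon>. B / \<eta> * (1 - 4 * (?Z \<epsilon> - 1)\<^sup>2))"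
    unfolding sign_avg_cmult sign_avg_diff sign_avg_const ..
  also have "\<dots> \<le> sign_avg T (\<lambda>\<epsilon>. \<Sum>i = 1..N. p \<epsilon> i * corr \<epsilon> i)"
    by (intro sign_avg_mono gain)
  finally have g: "B / \<eta> * (1 / 2) \<le> sign_avg T (\<lambda>\<epsilon>. \<Sum>i = 1..N. p \<epsilon> i * corr \<epsilon> i)" .
  have "sign_avg T (\<lambda>\<epsilon>. \<Sum>i = 1..N. (p \<epsilon> i)\<^sup>2) \<le>
      sign_avg T (\<lambda>\<epsilon>. \<Sum>i = 1..N. 4 / (real N)\<^sup>2 * exp ((2 * \<eta>) * corr \<epsilon> i))"
    by (intro sign_avg_mono sum_mono pen)
  also have "\<dots> = (\<Sum>i = 1..N. 4 / (real N)\<^sup>2 * cosh (2 * \<eta>) ^ N)"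
    unfolding sign_avg_sum sign_avg_cmult
    by (intro sum.cong refl arg_cong2[where f = "(*)"] sign_avg_exp_corr)
  also have "\<dots> = 4 / N * cosh (2 * \<eta>) ^ N" using N0 by (simp add: power2_eq_square)
  also have "\<dots> \<le> 4 / N * exp (2 * \<eta>\<^sup>2) ^ N"
    using cosh_le_exp_square[of "2 * \<eta>"]
    by (intro mult_left_mono power_mono) (auto simp: power_mult_distrib)
  also have "\<dots> = 4 / N * exp (2 * \<eta>\<^sup>2 * N)" by (simp add: mult.commute flip: exp_of_nat_mult)
  finally have "N * sign_avg T (\<lambda>\<epsilon>. \<Sum>i = 1..N. (p \<epsilon> i)\<^sup>2) / 8 \<le> N * (4 / N * exp (2 * \<eta>\<^sup>2 * N)) / 8"
    by (intro divide_right_mono mult_left_mono) auto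
  also have "\<dots> = exp (2 * \<eta>\<^sup>2 * N) / 2" using N0 by simp
  finally have "B / (8 * \<eta>) - exp (2 * \<eta>\<^sup>2 * N) / 2 \<le>
    sign_avg T (\<lambda>\<epsilon>. (\<Sum>i = 1..N. p \<epsilon> i * corr \<epsilon> i) / 4 - N * (\<Sum>i = 1..N. (p \<epsilon> i)\<^sup>2) / 8)"
    using g unfolding sign_avg_diff sign_avg_divide sign_avg_cmult by simp
  with p0 p1 show ?thesis by blast
qed

end

text \<open>With \<open>\<eta>^2 = ln x / (4 * x)\<close>, \<open>exp (\<eta>^2 * x)\<close> is the
  fourth root of \<open>x\<close>, so the variance condition holds eventually, and the penalty is
  \<open>sqrt x / 2\<close>. The gain is at least \<open>sqrt (x * ln x) / 64\<close>;
  \<open>64 ^ 2 \<le> ln x\<close> lets the penalty take at most half of it. The remaining 1/128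
  becomes 1/512 because the horizon can be as large as \<open>4 * x\<close> and
  \<open>ln (exp 1 * (4 * x)) \<le> 4 * ln x\<close>.\<close>

lemma eventually_parameters:
  "\<forall>\<^sub>F x::real in at_top. \<exists>\<eta> B. 0 < \<eta> \<and> \<eta>\<^sup>2 \<le> 2 \<and>
     exp (x * \<eta> ^ 4 / 2) * (1 + \<eta>\<^sup>2 * sqrt (2 * x) * exp (\<eta>\<^sup>2 * x)) \<le> 9 / 8 \<and>
     B = x * (\<eta>\<^sup>2 / 2 - \<eta> ^ 4 / 4) - ln 2 \<and> 0 \<le> B \<and>
     1 / 512 * sqrt (4 * x * ln (exp 1 * (4 * x))) \<le> B / (8 * \<eta>) - exp (2 * \<eta>\<^sup>2 * x) / 2"
proof -
  have "\<forall>\<^sub>F x::real in at_top. exp (x * (ln x / (4 * x))\<^sup>2 / 2) *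
      (1 + ln x / (4 * x) * sqrt (2 * x) * exp (ln x / (4 * x) * x)) \<le> 9 / 8"
    by real_asymp
  moreover have "\<forall>\<^sub>F x::real in at_top. ln x / (4 * x) \<le> 2" by real_asymp
  moreover have "\<forall>\<^sub>F x::real in at_top. ln x / 16 \<le> x * (ln x / (4 * x) / 2 - (ln x / (4 * x))\<^sup>2 / 4) - ln 2"
    by real_asymp
  moreover have "\<forall>\<^sub>F x::real in at_top. 64 ^ 2 \<le> ln x" by real_asymp
  moreover have "\<forall>\<^sub>F x::real in at_top. ln (exp 1 * (4 * x)) \<le> 4 * ln x" by real_asymp
  moreover have "\<forall>\<^sub>F x::real in at_top. 1 \<le> x" by real_asymp
  ultimately show ?thesis
  proof eventually_elim
    case (elim x)
    define \<eta> where "\<eta> = sqrt (ln x / (4 * x))"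
    define B where "B = x * (\<eta>\<^sup>2 / 2 - \<eta> ^ 4 / 4) - ln 2"
    have x: "0 < x" "64 ^ 2 \<le> ln x" using elim by auto
    have lx: "0 < ln x" by (rule less_le_trans[OF _ x(2)]) simp
    then have \<eta>: "0 < \<eta>" using x by (simp add: \<eta>_def)
    have sq: "\<eta>\<^sup>2 = ln x / (4 * x)" using x lx by (simp add: \<eta>_def)
    have "\<eta> ^ 4 = (\<eta>\<^sup>2)\<^sup>2" by (simp flip: power_mult)
    then have four: "\<eta> ^ 4 = (ln x / (4 * x))\<^sup>2" unfolding sq .
    have B: "ln x / 16 \<le> B" unfolding B_def four sq using elim by simp
    have "sqrt (4 * x * ln (exp 1 * (4 * x))) \<le> sqrt (4 * x * (4 * ln x))"
      using elim x by (intro real_sqrt_le_mono mult_left_mono) auto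
    also have "\<dots> = 4 * sqrt (x * ln x)"
      using real_sqrt_mult[of 16 "x * ln x"] by (simp add: real_sqrt_unique[of 4 16] mult_ac)
    finally have lhs: "1 / 512 * sqrt (4 * x * ln (exp 1 * (4 * x))) \<le> sqrt (x * ln x) / 128" by simp
    have "64 = sqrt (64 ^ 2)" by simp
    also have "\<dots> \<le> sqrt (ln x)" using x by (intro real_sqrt_le_mono)
    finally have "sqrt x * 64 \<le> sqrt x * sqrt (ln x)" using x by (intro mult_left_mono) auto
    moreover have "exp (2 * \<eta>\<^sup>2 * x) = sqrt x"
    proof -
      have "2 * \<eta>\<^sup>2 * x = ln x / 2" using x by (simp add: sq)
      then show ?thesis using x by (simp flip: ln_sqrt)
    qed
    ultimately have pen: "exp (2 * \<eta>\<^sup>2 * x) / 2 \<le> sqrt (x * ln x) / 128"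
      by (simp add: real_sqrt_mult)
    have "sqrt (x * ln x) * \<eta> = ln x / 2"
    proof -
      have "sqrt (x * ln x) * \<eta> = sqrt ((ln x / 2)\<^sup>2)"
        using x unfolding \<eta>_def real_sqrt_mult[symmetric]
        by (intro arg_cong[where f = sqrt]) (simp add: power2_eq_square)
      then show ?thesis using x lx by simp
    qed
    then have "sqrt (x * ln x) / 64 = ln x / 16 / (8 * \<eta>)" using \<eta> by (simp add: field_simps)
    also have "\<dots> \<le> B / (8 * \<eta>)" using B \<eta> by (intro divide_right_mono) auto
    finally have "1 / 512 * sqrt (4 * x * ln (exp 1 * (4 * x))) \<le> B / (8 * \<eta>) - exp (2 * \<eta>\<^sup>2 * x) / 2"
      using lhs pen by simp
    moreover have "0 \<le> B" using B x by simp
    moreover have "exp (x * \<eta> ^ 4 / 2) * (1 + \<eta>\<^sup>2 * sqrt (2 * x) * exp (\<eta>\<^sup>2 * x)) \<le> 9 / 8"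
      using elim(1) unfolding four sq .
    moreover have "\<eta>\<^sup>2 \<le> 2" using elim(2) unfolding sq .
    ultimately show ?case using \<eta> B_def by blast
  qed
qed

section \<open>The hard instance\<close>

definition tracking_cost :: "real \<Rightarrow> real \<Rightarrow> real \<Rightarrow> cost" where
  "tracking_cost \<mu> z k y = \<mu> / 2 * ((fst y - z)\<^sup>2 + (snd y)\<^sup>2) + k * snd y"

lemma GDERIV_tracking_cost:
  "GDERIV (tracking_cost \<mu> z k) y :> (\<mu> * (fst y - z), \<mu> * snd y + k)"
proof -
  have "(tracking_cost \<mu> z k has_derivative
      (\<lambda>h. \<mu> / 2 * (2 * (fst y - z) * fst h + 2 * snd y * snd h) + k * snd h)) (at y)"
    unfolding tracking_cost_def[abs_def]
    by (auto intro!: derivative_eq_intros ext simp: field_simps)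
  then show ?thesis
    unfolding gderiv_def by (rule has_derivative_subst) (auto simp: inner_prod_def field_simps)
qed

lemma differentiable_tracking_cost: "tracking_cost \<mu> z k differentiable (at y)"
  using GDERIV_tracking_cost unfolding gderiv_def differentiable_def by blast

lemma grad_tracking_cost: "grad (tracking_cost \<mu> z k) y = (\<mu> * (fst y - z), \<mu> * snd y + k)"
  by (rule grad_eqI[OF GDERIV_tracking_cost])

lemma power2_norm_prod: "(norm (y :: real \<times> real))\<^sup>2 = (fst y)\<^sup>2 + (snd y)\<^sup>2"
  by (simp add: norm_prod_def)

lemma strongly_convex_tracking_cost: "strongly_convex \<mu> (tracking_cost \<mu> z k)"
proof -
  have "tracking_cost \<mu> z k y + inner (grad (tracking_cost \<mu> z k) y) (y' - y) + \<mu> / 2 * (norm (y' - y))\<^sup>2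
      = tracking_cost \<mu> z k y'" for y y'
    unfolding grad_tracking_cost power2_norm_prod tracking_cost_def inner_prod_def
    by (simp add: field_simps power2_eq_square)
  then show ?thesis
    unfolding strongly_convex_def using differentiable_tracking_cost by (metis order_refl)
qed

lemma convex_differentiable_tracking_cost:
  assumes "0 \<le> \<mu>"
  shows "convex_differentiable (tracking_cost \<mu> z k)"
  unfolding convex_differentiable_def
proof (intro conjI allI differentiable_tracking_cost convex_onI)
  fix t :: real and a b :: "real \<times> real"
  assume t: "0 < t" "t < 1"
  have "(1 - t) * tracking_cost \<mu> z k a + t * tracking_cost \<mu> z k b
      - tracking_cost \<mu> z k ((1 - t) *\<^sub>R a + t *\<^sub>R b)
      = \<mu> / 2 * (t * (1 - t) * ((fst a - fst b)\<^sup>2 + (snd a - snd b)\<^sup>2))"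
    unfolding tracking_cost_def by (simp add: field_simps power2_eq_square)
  also have "0 \<le> \<dots>" using t assms by simp
  finally show "tracking_cost \<mu> z k ((1 - t) *\<^sub>R a + t *\<^sub>R b) \<le>
      (1 - t) * tracking_cost \<mu> z k a + t * tracking_cost \<mu> z k b" by simp
qed simp

lemma regular_tracking_cost:
  assumes "0 \<le> \<mu>" and le: "\<mu> * (D + \<bar>z\<bar>) + \<bar>k\<bar> \<le> G * D"
  shows "regular_cost G D (tracking_cost \<mu> z k)"
  unfolding regular_cost_def
proof (intro conjI allI impI convex_differentiable_tracking_cost assms(1))
  fix y :: "real \<times> real" assume y: "norm y \<le> D"
  have "grad (tracking_cost \<mu> z k) y = \<mu> *\<^sub>R (y - (z, 0)) + (0, k)"
    by (simp add: grad_tracking_cost prod_eq_iff)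
  also have "norm \<dots> \<le> \<mu> * (norm y + norm (z, 0 :: real)) + norm (0 :: real, k)"
    using assms(1) norm_triangle_ineq4[of y "(z, 0)"]
    by (intro order_trans[OF norm_triangle_ineq] add_right_mono) (simp add: mult_left_mono)
  also have "\<dots> \<le> \<mu> * (D + \<bar>z\<bar>) + \<bar>k\<bar>"
    using y assms(1) by (simp add: norm_Pair mult_left_mono)
  finally show "norm (grad (tracking_cost \<mu> z k) y) \<le> G * D" using le by simp
qed

text \<open>The first bound, by completing the square, is uniform in \<open>y\<close>: it makes
  infima genuine and regret bounded below. The second drops the quadratic part and is what averages
  out for a controller.\<close>

lemma tracking_cost_lower:
  assumes "0 < \<mu>"
  shows "- (k\<^sup>2 / (2 * \<mu>)) \<le> tracking_cost \<mu> z k y" "k * snd y \<le> tracking_cost \<mu> z k y"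
proof -
  have "0 \<le> \<mu> / 2 * (fst y - z)\<^sup>2 + \<mu> / 2 * (snd y + k / \<mu>)\<^sup>2" using assms by simp
  also have "\<dots> = tracking_cost \<mu> z k y + k\<^sup>2 / (2 * \<mu>)"
    using assms unfolding tracking_cost_def by (simp add: field_simps power2_eq_square)
  finally show "- (k\<^sup>2 / (2 * \<mu>)) \<le> tracking_cost \<mu> z k y" by simp
  show "k * snd y \<le> tracking_cost \<mu> z k y"
    using assms by (simp add: tracking_cost_def)
qed

text \<open>Causality in the form used below: an action does not change when the cost of its own
  round does, hence it is independent of that round's sign.\<close>

lemma action_cong_costs:
  assumes "\<And>s. s \<in> {1..<t} \<Longrightarrow> c s = c' s"
  shows "action p w c t = action p w c' t"
proof -
  have m: "map c [1..<n] = map c' [1..<n]" if "n \<le> t" for n using assms that by auto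
  \<comment> \<open>The alternative \<open>n = 0\<close> covers \<open>t = 0\<close>, where the
    truncated \<open>t - 1\<close> is not below \<open>t\<close>.\<close>
  have "states p w c n = states p w c' n" if "n < t \<or> n = 0" for n
    using that
  proof (induction n)
    case (Suc n)
    then have "states p w c n = states p w c' n" "map c [1..<Suc n] = map c' [1..<Suc n]"
      using m[of "Suc n"] by auto
    then show ?case by (simp only: states.simps)
  qed simp
  then have "states p w c (t - 1) = states p w c' (t - 1)" by (metis diff_less not_gr_zero zero_less_one zero_diff)
  then show ?thesis unfolding action_def using m[of t] by (simp only: order_refl)
qed

definition response_of :: "(nat \<Rightarrow> real) \<Rightarrow> response" where
  "response_of a = ((\<lambda>i. if i = 1 then 1 else a (i - 1)), a)"

text \<open>Each gain is counted twice, as a control entry at its own index and as a state entry one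
  index later; hence the factor 2.\<close>

lemma response_of_in_ball:
  assumes a: "\<And>i. i \<notin> {1..n} \<Longrightarrow> a i = 0" and le: "2 * (\<Sum>i = 1..n. \<bar>a i\<bar>) \<le> R"
  shows "response_of a \<in> response_ball R"
proof -
  have dev: "deviation (response_of a) (Suc i) \<le> \<bar>a i\<bar> + \<bar>a (Suc i)\<bar>" for i
    using a[of 0] sqrt_sum_squares_le_sum_abs[of "a i" "a (Suc i)"]
    by (cases i) (simp_all add: deviation_def response_of_def baseline_def)
  have "deviation (response_of a) (Suc i) = 0" if "i \<notin> {..n}" for i
    using that a[of i] a[of "Suc i"] by (simp add: deviation_def response_of_def baseline_def)
  then have sums: "(\<lambda>i. deviation (response_of a) (Suc i)) sums (\<Sum>i\<le>n. deviation (response_of a) (Suc i))"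
    by (intro sums_finite) auto
  have "(\<Sum>i\<le>n. deviation (response_of a) (Suc i)) \<le> (\<Sum>i\<le>n. \<bar>a i\<bar>) + (\<Sum>i\<le>n. \<bar>a (Suc i)\<bar>)"
    unfolding sum.distrib[symmetric] by (intro sum_mono dev)
  also have "(\<Sum>i\<le>n. \<bar>a i\<bar>) = (\<Sum>i = 1..n. \<bar>a i\<bar>)"
    using a[of 0] by (intro sum.mono_neutral_right) (auto simp: not_less_eq_eq)
  also have "(\<Sum>i\<le>n. \<bar>a (Suc i)\<bar>) = (\<Sum>i\<in>{1..Suc n}. \<bar>a i\<bar>)"
    by (intro sum.reindex_bij_witness[of _ "\<lambda>i. i - 1" Suc]) auto
  also have "\<dots> = (\<Sum>i = 1..n. \<bar>a i\<bar>)" using a[of "Suc n"] by simp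
  finally show ?thesis using sums_summable[OF sums] sums_unique[OF sums] le
    by (simp add: response_ball_def is_response_def response_of_def)
qed

lemma cINF_le_of_tracking_costs:
  assumes "0 < \<mu>" "\<Phi> \<in> response_ball R"
  shows "(INF \<Phi>\<in>response_ball R. \<Sum>t = 1..T. tracking_cost \<mu> (z t) (k t) (trajectory \<Phi> w t))
    \<le> (\<Sum>t = 1..T. tracking_cost \<mu> (z t) (k t) (trajectory \<Phi> w t))"
proof (rule cINF_lower[OF _ assms(2)])
  show "bdd_below ((\<lambda>\<Phi>. \<Sum>t = 1..T. tracking_cost \<mu> (z t) (k t) (trajectory \<Phi> w t)) ` response_ball R)"
    using tracking_cost_lower(1)[OF assms(1)]
    by (intro bdd_belowI2[of _ "\<Sum>t = 1..T. - ((k t)\<^sup>2 / (2 * \<mu>))"] sum_mono) auto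
qed

locale hard_instance = flat_sequence +
  fixes W R \<mu> G D :: real
  assumes pos: "0 < W" "0 < R" "0 < \<mu>" and G: "4 * \<mu> \<le> G" and D: "D = W * (1 + 3 * exp 1 * R)"
begin

definition disturbance :: "nat \<Rightarrow> real" where
  "disturbance s = W * r s"

text \<open>The slope takes half of the gradient budget \<open>G * D\<close>. The condition
  \<open>4 * \<mu> \<le> G\<close> fits the quadratic part, of gradient at most
  \<open>2 * \<mu> * D\<close> on the ball, into the other half.\<close>

definition costs :: "(nat \<Rightarrow> real) \<Rightarrow> nat \<Rightarrow> cost" where
  "costs \<epsilon> t = tracking_cost \<mu> (disturbance (t - 1)) (G * D / 2 * \<epsilon> t)"

lemma D_ge: "W \<le> D" "R * W \<le> D" "0 < D"
proof -
  have "W * 1 \<le> W * (1 + 3 * exp 1 * R)" using pos by (intro mult_left_mono) auto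
  then show "W \<le> D" by (simp add: D)
  have "1 * (R * W) \<le> 3 * exp 1 * (R * W)"
    using pos exp_ge_add_one_self[of 1] by (intro mult_right_mono) auto
  moreover have "D = W + 3 * exp 1 * (R * W)" by (simp add: D algebra_simps)
  ultimately show "R * W \<le> D" using pos by linarith
  show "0 < D" using \<open>W \<le> D\<close> pos by simp
qed

lemma abs_disturbance: "\<bar>disturbance s\<bar> \<le> W"
  using abs_r[of s] pos by (auto simp: disturbance_def abs_mult split: if_splits)

lemma disturbance_0: "disturbance 0 = 0"
  using abs_r[of 0] by (simp add: disturbance_def)

lemma lag_disturbance: "lag disturbance t i = W * lag r t i"
  by (simp add: lag_def disturbance_def)

lemma regular_costs:
  assumes "\<epsilon> \<in> signs T" "t \<in> {1..T}"
  shows "regular_cost G D (costs \<epsilon> t)"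
  unfolding costs_def
proof (rule regular_tracking_cost)
  have "\<mu> * (D + \<bar>disturbance (t - 1)\<bar>) \<le> \<mu> * (2 * D)"
    using abs_disturbance[of "t - 1"] D_ge pos by (intro mult_left_mono) auto
  moreover have "4 * \<mu> * D \<le> G * D" using G D_ge by (intro mult_right_mono) auto
  moreover have "\<bar>G * D / 2 * \<epsilon> t\<bar> = G * D / 2"
    using abs_sign[OF assms] G pos D_ge by (simp add: abs_mult)
  ultimately show "\<mu> * (D + \<bar>disturbance (t - 1)\<bar>) + \<bar>G * D / 2 * \<epsilon> t\<bar> \<le> G * D" by simp
qed (use pos in simp)

text \<open>For each fixed policy, the quadratic part is nonnegative and the linear part has mean
  zero, since the sign of round \<open>t\<close> is revealed only after the action of round
  \<open>t\<close>.\<close>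

lemma sign_avg_controller_cost:
  "0 \<le> sign_avg T (\<lambda>\<epsilon>. \<Sum>t = 1..T. costs \<epsilon> t (state p w (costs \<epsilon>) t, action p w (costs \<epsilon>) t))"
proof -
  have "sign_avg T (\<lambda>\<epsilon>. \<epsilon> t * action p w (costs \<epsilon>) t) = 0" if "t \<in> {1..T}" for t
    using that by (intro sign_avg_mult_independent action_cong_costs) (auto simp: costs_def)
  then have "0 = sign_avg T (\<lambda>\<epsilon>. \<Sum>t = 1..T. G * D / 2 * (\<epsilon> t * action p w (costs \<epsilon>) t))"
    unfolding sign_avg_sum sign_avg_cmult by simp
  also have "\<dots> \<le> sign_avg T (\<lambda>\<epsilon>. \<Sum>t = 1..T. costs \<epsilon> t (state p w (costs \<epsilon>) t, action p w (costs \<epsilon>) t))"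
    unfolding costs_def
    by (intro sign_avg_mono sum_mono order_trans[OF _ tracking_cost_lower(2)[OF pos(3)]]) simp
  finally show ?thesis .
qed

text \<open>The comparator uses gains \<open>- R / 2 * q i\<close>, opposing the signs; the half is
  what \<open>response_of_in_ball\<close> demands. With slope \<open>G * D / 2\<close>, the linear
  gain carries the factor 1/4.\<close>

lemma comparator_cost:
  fixes q :: "nat \<Rightarrow> real"
  assumes q: "\<And>i. 0 \<le> q i" "(\<Sum>i = 1..N. q i) \<le> 1"
  shows "(INF \<Phi>\<in>response_ball R. \<Sum>t = 1..T. costs \<epsilon> t (trajectory \<Phi> disturbance t))
    \<le> - (G * D * W * R * ((\<Sum>i = 1..N. q i * corr \<epsilon> i) / 4 - N * (\<Sum>i = 1..N. (q i)\<^sup>2) / 8))"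
proof -
  define a where "a i = (if i \<in> {1..N} then - (R / 2 * q i) else 0)" for i
  define v where "v t = (\<Sum>i = 1..N. a i * lag r t i)" for t
  let ?\<Phi> = "response_of a"
  have "(\<Sum>i = 1..N. \<bar>a i\<bar>) = R / 2 * (\<Sum>i = 1..N. q i)"
    using pos q unfolding sum_distrib_left by (intro sum.cong) (auto simp: a_def abs_mult)
  also have "\<dots> \<le> R / 2 * 1" using q pos by (intro mult_left_mono) auto
  finally have ball: "?\<Phi> \<in> response_ball R"
    by (intro response_of_in_ball[of N]) (auto simp: a_def)
  have u: "snd (trajectory ?\<Phi> disturbance t) = W * v t" if "t \<le> T" for t
  proof -
    have "snd (trajectory ?\<Phi> disturbance t) = (\<Sum>i = 1..T. a i * lag disturbance t i)"
      using that by (subst snd_trajectory[of t T]) (auto simp: response_of_def)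
    also have "\<dots> = (\<Sum>i = 1..N. a i * lag disturbance t i)"
      using N by (intro sum.mono_neutral_right) (auto simp: a_def)
    finally show ?thesis by (simp add: v_def lag_disturbance sum_distrib_left mult_ac)
  qed
  \<comment> \<open>The centre of the cost removes the disturbance, so the state is penalised by the
    comparator's previous action alone.\<close>
  have x: "fst (trajectory ?\<Phi> disturbance t) - disturbance (t - 1) = W * v (t - 1)" if t: "t \<in> {1..T}" for t
  proof (cases "t = 1")
    case True
    then show ?thesis by (simp add: trajectory_def disturbance_0 v_def lag_def)
  next
    case False
    then have "fst (trajectory ?\<Phi> disturbance (Suc (t - 1))) = disturbance (t - 1) + snd (trajectory ?\<Phi> disturbance (t - 1))"
      using t ball by (intro fst_trajectory_Suc) (auto simp: response_ball_def)
    moreover have "t - 1 \<le> T" using t by auto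
    ultimately show ?thesis using t u[of "t - 1"] by simp
  qed
  have "(\<Sum>t = 1..T. costs \<epsilon> t (trajectory ?\<Phi> disturbance t)) =
      (\<Sum>t = 1..T. \<mu> / 2 * W\<^sup>2 * ((v (t - 1))\<^sup>2 + (v t)\<^sup>2) + G * D / 2 * W * (\<epsilon> t * v t))"
    using x u by (intro sum.cong refl)
      (simp add: costs_def tracking_cost_def power_mult_distrib distrib_left mult_ac)
  also have "\<dots> = \<mu> / 2 * W\<^sup>2 * ((\<Sum>t = 1..T. (v (t - 1))\<^sup>2) + (\<Sum>t = 1..T. (v t)\<^sup>2))
      + G * D / 2 * W * (\<Sum>t = 1..T. \<epsilon> t * v t)"
    by (simp only: sum.distrib sum_distrib_left[symmetric])
  also have "(\<Sum>t = 1..T. \<epsilon> t * v t) = (\<Sum>i = 1..N. a i * corr \<epsilon> i)"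
    unfolding v_def corr_def sum_distrib_left
    by (subst sum.swap) (intro sum.cong refl, simp add: mult_ac)
  also have "\<dots> = - (R / 2 * (\<Sum>i = 1..N. q i * corr \<epsilon> i))"
    unfolding sum_distrib_left sum_negf[symmetric] by (intro sum.cong) (auto simp: a_def)
  also have "\<mu> / 2 * W\<^sup>2 * ((\<Sum>t = 1..T. (v (t - 1))\<^sup>2) + (\<Sum>t = 1..T. (v t)\<^sup>2))
      \<le> G * D * W * R * (N * (\<Sum>i = 1..N. (q i)\<^sup>2) / 8)"
  proof -
    let ?E = "\<Sum>t = 1..T. (v t)\<^sup>2" and ?Q = "\<Sum>i = 1..N. (q i)\<^sup>2"
    have "(\<Sum>t = 1..T. (v (t - 1))\<^sup>2) = (\<Sum>t<T. (v t)\<^sup>2)"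
      by (intro sum.reindex_bij_witness[of _ Suc "\<lambda>t. t - 1"]) auto
    also have "\<dots> \<le> (\<Sum>t\<in>{0..T}. (v t)\<^sup>2)" by (intro sum_mono2) auto
    also have "\<dots> = ?E" by (subst sum.atLeast_Suc_atMost) (auto simp: v_def lag_def)
    finally have 1: "(\<Sum>t = 1..T. (v (t - 1))\<^sup>2) \<le> ?E" .
    have "?E \<le> 2 * real N * (\<Sum>i = 1..N. (a i)\<^sup>2)" unfolding v_def by (rule flat)
    also have "(\<Sum>i = 1..N. (a i)\<^sup>2) = R\<^sup>2 / 4 * ?Q"
      unfolding sum_distrib_left
      by (intro sum.cong) (auto simp: a_def power_mult_distrib power_divide)
    finally have "(\<Sum>t = 1..T. (v (t - 1))\<^sup>2) + ?E \<le> N * R\<^sup>2 * ?Q" using 1 by simp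
    then have "\<mu> / 2 * W\<^sup>2 * ((\<Sum>t = 1..T. (v (t - 1))\<^sup>2) + ?E) \<le> \<mu> / 2 * W\<^sup>2 * (N * R\<^sup>2 * ?Q)"
      using pos by (intro mult_left_mono) auto
    \<comment> \<open>Regrouped so that \<open>4 * \<mu> \<le> G\<close> and
      \<open>R * W \<le> D\<close> apply, leaving the factor 1/8.\<close>
    also have "\<dots> = (4 * \<mu>) * (W * R) * ((R * W) * (N * ?Q / 8))" by (simp add: power2_eq_square)
    also have "\<dots> \<le> G * (W * R) * (D * (N * ?Q / 8))"
      using G pos D_ge sum_nonneg[of "{1..N}" "\<lambda>i. (q i)\<^sup>2"] by (intro mult_mono mult_right_mono) auto
    finally show ?thesis by (simp add: mult_ac)
  qed
  finally have "(\<Sum>t = 1..T. costs \<epsilon> t (trajectory ?\<Phi> disturbance t)) \<le>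
      - (G * D * W * R * ((\<Sum>i = 1..N. q i * corr \<epsilon> i) / 4 - N * (\<Sum>i = 1..N. (q i)\<^sup>2) / 8))"
    by (simp add: algebra_simps)
  then show ?thesis
    using cINF_le_of_tracking_costs[OF pos(3) ball, where T = T] unfolding costs_def by (rule order_trans[rotated])
qed

lemma sign_avg_regret:
  fixes p :: "(nat \<Rightarrow> real) \<Rightarrow> nat \<Rightarrow> real"
  assumes p: "\<And>\<epsilon> i. 0 \<le> p \<epsilon> i" "\<And>\<epsilon>. (\<Sum>i = 1..N. p \<epsilon> i) \<le> 1"
  shows "G * D * W * R * sign_avg T (\<lambda>\<epsilon>. (\<Sum>i = 1..N. p \<epsilon> i * corr \<epsilon> i) / 4 - N * (\<Sum>i = 1..N. (p \<epsilon> i)\<^sup>2) / 8)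
    \<le> sign_avg T (\<lambda>\<epsilon>. regret T R \<pi> disturbance (costs \<epsilon>))"
proof -
  have "sign_avg T (\<lambda>\<epsilon>. INF \<Phi>\<in>response_ball R. \<Sum>t = 1..T. costs \<epsilon> t (trajectory \<Phi> disturbance t)) \<le>
    sign_avg T (\<lambda>\<epsilon>. - (G * D * W * R * ((\<Sum>i = 1..N. p \<epsilon> i * corr \<epsilon> i) / 4 - N * (\<Sum>i = 1..N. (p \<epsilon> i)\<^sup>2) / 8)))"
    by (intro sign_avg_mono comparator_cost p)
  also have "\<dots> = - (G * D * W * R) * sign_avg T (\<lambda>\<epsilon>. (\<Sum>i = 1..N. p \<epsilon> i * corr \<epsilon> i) / 4 - N * (\<Sum>i = 1..N. (p \<epsilon> i)\<^sup>2) / 8)"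
    unfolding sign_avg_cmult[symmetric] by simp
  finally show ?thesis
    using sign_avg_controller_cost[of \<pi> disturbance] unfolding regret_def sign_avg_diff by simp
qed

text \<open>A bound uniform in policy and signs, so that the expected regret is well defined for
  every controller.\<close>

lemma regret_ge:
  "- (T * ((G * D / 2)\<^sup>2 / (2 * \<mu>))) \<le> regret T R \<pi> disturbance (costs \<epsilon>)" if "\<epsilon> \<in> signs T"
proof -
  have "(INF \<Phi>\<in>response_ball R. \<Sum>t = 1..T. costs \<epsilon> t (trajectory \<Phi> disturbance t)) \<le> 0"
    using comparator_cost[of "\<lambda>_. 0" \<epsilon>] by simp
  moreover have "(\<Sum>t = 1..T. - ((G * D / 2)\<^sup>2 / (2 * \<mu>))) \<le>
      (\<Sum>t = 1..T. costs \<epsilon> t (state \<pi> disturbance (costs \<epsilon>) t, action \<pi> disturbance (costs \<epsilon>) t))"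
  proof (rule sum_mono)
    fix t assume "t \<in> {1..T}"
    then have "(\<epsilon> t)\<^sup>2 = 1" using abs_sign[OF that, of t] by (metis one_power2 power2_abs)
    then have "(G * D / 2 * \<epsilon> t)\<^sup>2 = (G * D / 2)\<^sup>2" by (simp add: power_mult_distrib power_divide)
    then show "- ((G * D / 2)\<^sup>2 / (2 * \<mu>)) \<le>
        costs \<epsilon> t (state \<pi> disturbance (costs \<epsilon>) t, action \<pi> disturbance (costs \<epsilon>) t)"
      unfolding costs_def using tracking_cost_lower(1)[OF pos(3), of "G * D / 2 * \<epsilon> t"] by simp
  qed
  ultimately show ?thesis by (simp add: regret_def)
qed

end

section \<open>Expectations over signs and private seeds\<close>

lemma ennreal_pos_part_add:
  fixes x K :: real
  assumes "0 \<le> K" "0 \<le> x + K"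
  shows "ennreal x + ennreal K = ennreal (x + K) + ennreal (- x)"
  using assms by (cases "0 \<le> x") (auto simp: ennreal_neg simp flip: ennreal_plus)

text \<open>Shifting by \<open>K\<close> makes everything nonnegative, so no integrability is
  required. The negative part is finite and can be subtracted; an infinite positive part makes the
  bound trivial.\<close>

lemma expectation_of_bounded_below:
  assumes P: "prob_space P" and X: "X \<in> borel_measurable P"
    and K: "0 \<le> K" "\<And>z. z \<in> space P \<Longrightarrow> - K \<le> X z" and L: "0 \<le> L"
    and le: "ennreal (L + K) \<le> (\<integral>\<^sup>+ z. ennreal (X z + K) \<partial>P)"
  shows "has_expectation P X \<and> ereal L \<le> expect P X"
proof -
  interpret prob_space P by fact
  let ?p = "\<integral>\<^sup>+ z. ennreal (X z) \<partial>P" and ?n = "\<integral>\<^sup>+ z. ennreal (- X z) \<partial>P"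
  have [measurable]: "X \<in> borel_measurable P" by fact
  have "?n \<le> (\<integral>\<^sup>+ z. ennreal K \<partial>P)"
    using K by (intro nn_integral_mono ennreal_leI) (simp add: minus_le_iff)
  then have n: "?n \<le> ennreal K" by (simp add: emeasure_space_1)
  then have fin: "?n < \<infinity>" using ennreal_less_top le_less_trans by (metis infinity_ennreal_def)
  have "?p + ennreal K = (\<integral>\<^sup>+ z. ennreal (X z) + ennreal K \<partial>P)"
    by (subst nn_integral_add) (simp_all add: emeasure_space_1)
  also have "\<dots> = (\<integral>\<^sup>+ z. ennreal (X z + K) + ennreal (- X z) \<partial>P)"
  proof (rule nn_integral_cong)
    fix z assume "z \<in> space P"
    from K(2)[OF this] show "ennreal (X z) + ennreal K = ennreal (X z + K) + ennreal (- X z)"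
      using K(1) by (intro ennreal_pos_part_add) auto
  qed
  also have "\<dots> = (\<integral>\<^sup>+ z. ennreal (X z + K) \<partial>P) + ?n" by (subst nn_integral_add) simp_all
  finally have eq: "ennreal (L + K) + ?n \<le> ?p + ennreal K" using le by (simp add: add_right_mono)
  obtain m where m: "?n = ennreal m" "0 \<le> m" using fin by (cases ?n) auto
  have "ereal L \<le> enn2ereal ?p - enn2ereal ?n"
  proof (cases ?p)
    case (real q)
    have "ennreal (L + K + m) \<le> ennreal (q + K)"
      using eq real m L K(1) by (simp flip: ennreal_plus)
    then have "L + m \<le> q" using real L K(1) m by (simp add: ennreal_le_iff del: ennreal_plus)
    then show ?thesis using real m by (simp add: enn2ereal_ennreal)
  next
    case top
    then show ?thesis using m by (simp add: enn2ereal_ennreal)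
  qed
  then show ?thesis using X fin by (simp add: has_expectation_def expect_def)
qed

context hard_instance begin

definition env :: "(nat \<Rightarrow> real) \<Rightarrow> (nat \<Rightarrow> real) \<times> (nat \<Rightarrow> cost)" where
  "env \<epsilon> = (disturbance, costs \<epsilon>)"

text \<open>The discrete sigma-algebra on the finitely many values makes every function of the environment
  measurable.\<close>

definition law :: "((nat \<Rightarrow> real) \<times> (nat \<Rightarrow> cost)) measure" where
  "law = distr (uniform_count_measure (signs T)) (count_space (env ` signs T)) env"

lemma signs_ne: "signs T \<noteq> {}"
  by (simp add: signs_def PiE_eq_empty_iff)

lemma env_measurable: "env \<in> measurable (uniform_count_measure (signs T)) (count_space (env ` signs T))"
  by (simp add: measurable_def space_uniform_count_measure sets_uniform_count_measure)

lemma prob_space_law: "prob_space law"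
  unfolding law_def
  by (intro prob_space.prob_space_distr prob_space_uniform_count_measure signs_ne env_measurable) simp

lemma sets_law: "sets law = sets (count_space (env ` signs T))" and space_law: "space law = env ` signs T"
  by (simp_all add: law_def)

lemma measurable_law: "f \<in> measurable law M \<longleftrightarrow> (\<forall>\<epsilon>\<in>signs T. f (env \<epsilon>) \<in> space M)"
  by (subst measurable_cong_sets[OF sets_law refl]) auto

lemma nn_integral_law:
  "(\<integral>\<^sup>+ z. f z \<partial>law) = (\<Sum>\<epsilon>\<in>signs T. ennreal (1 / 2 ^ T) * f (env \<epsilon>))"
proof -
  have "(\<integral>\<^sup>+ z. f z \<partial>law) = (\<integral>\<^sup>+ \<epsilon>. f (env \<epsilon>) \<partial>uniform_count_measure (signs T))"
    unfolding law_def by (rule nn_integral_distr[OF env_measurable]) simp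
  then show ?thesis
    unfolding uniform_count_measure_def by (simp add: nn_integral_point_measure_finite card_signs)
qed

lemma oblivious_law: "oblivious_law T law"
proof -
  have "costs \<epsilon> t \<in> space cost_space" for \<epsilon> t
    using convex_differentiable_tracking_cost[of \<mu>] pos
    by (simp add: cost_space_def space_restrict_space space_PiM costs_def)
  then show ?thesis
    unfolding oblivious_law_def by (auto simp: prob_space_law measurable_law env_def)
qed

lemma AE_law:
  "AE (w, f) in law. \<forall>t\<in>{1..T}. \<bar>w t\<bar> \<le> W \<and> strongly_convex \<mu> (f t) \<and> regular_cost G D (f t)"
  using regular_costs abs_disturbance strongly_convex_tracking_cost
  by (intro AE_I2) (auto simp: space_law env_def costs_def[of _ "_ :: nat"])

text \<open>For a fixed sign vector the infimum over responses is a constant, so only the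
  controller's own cost depends on the seed.\<close>

lemma regret_measurable:
  assumes c: "randomized_controller T law \<nu> p" and \<epsilon>: "\<epsilon> \<in> signs T"
  shows "(\<lambda>s. regret T R (p s) disturbance (costs \<epsilon>)) \<in> borel_measurable \<nu>"
proof -
  have act: "(\<lambda>s. action (p s) disturbance (costs \<epsilon>) t) \<in> borel_measurable \<nu>" if "t \<in> {1..T}" for t
  proof -
    have "(\<lambda>((w, c), s). action (p s) w c t) \<in> borel_measurable (law \<Otimes>\<^sub>M \<nu>)"
      using c that unfolding randomized_controller_def by blast
    from measurable_Pair2[OF this, of "env \<epsilon>"] show ?thesis
      using \<epsilon> by (simp add: space_law env_def)
  qed
  have st: "(\<lambda>s. state (p s) disturbance (costs \<epsilon>) t) \<in> borel_measurable \<nu>" if t: "t \<in> {1..T}" for t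
  proof (cases "t = 1")
    case True
    then show ?thesis by (simp add: state_def)
  next
    case False
    then have "t - 1 \<in> {1..T}" using t by auto
    from act[OF this] show ?thesis
      using t False by (simp add: state_eq_closed_loop_state closed_loop_state_def)
  qed
  have "(\<lambda>s. costs \<epsilon> t (state (p s) disturbance (costs \<epsilon>) t, action (p s) disturbance (costs \<epsilon>) t))
      \<in> borel_measurable \<nu>" if "t \<in> {1..T}" for t
  proof -
    have "costs \<epsilon> t (x, u) = \<mu> / 2 * ((x - disturbance (t - 1))\<^sup>2 + u\<^sup>2) + G * D / 2 * \<epsilon> t * u" for x u
      by (simp add: costs_def tracking_cost_def)
    then show ?thesis
      using act[OF that] st[OF that] by simp
  qed
  then show ?thesis unfolding regret_def by (intro borel_measurable_diff borel_measurable_sum) auto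
qed

text \<open>For each fixed seed the policy is deterministic and \<open>avg\<close> applies. Tonelli,
  for the regret shifted by \<open>K\<close>, then exchanges seed and signs; this is where
  independence of the two enters.\<close>

lemma expected_regret:
  assumes c: "randomized_controller T law \<nu> p" and L: "0 \<le> L"
    and avg: "\<And>\<pi>. L \<le> sign_avg T (\<lambda>\<epsilon>. regret T R \<pi> disturbance (costs \<epsilon>))"
  shows "has_expectation (law \<Otimes>\<^sub>M \<nu>) (\<lambda>((w, f), s). regret T R (p s) w f) \<and>
    ereal L \<le> expect (law \<Otimes>\<^sub>M \<nu>) (\<lambda>((w, f), s). regret T R (p s) w f)"
proof -
  let ?X = "\<lambda>((w, f), s). regret T R (p s) w f"
  define K where "K = T * ((G * D / 2)\<^sup>2 / (2 * \<mu>))"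
  have K: "0 \<le> K" using pos by (simp add: K_def)
  have "prob_space \<nu>" using c by (simp add: randomized_controller_def)
  then interpret \<nu>: prob_space \<nu> .
  have "\<And>x. x \<in> env ` signs T \<Longrightarrow> (\<lambda>s. ?X (x, s)) \<in> borel_measurable \<nu>"
    using regret_measurable[OF c] by (auto simp: env_def)
  \<comment> \<open>Over a countable discrete first factor, joint measurability follows from
    measurability of each section.\<close>
  then have "?X \<in> borel_measurable (count_space (env ` signs T) \<Otimes>\<^sub>M \<nu>)"
    by (intro measurable_pair_measure_countable1) (simp_all add: countable_finite)
  then have X [measurable]: "?X \<in> borel_measurable (law \<Otimes>\<^sub>M \<nu>)"
    by (subst measurable_cong_sets[OF sets_pair_measure_cong[OF sets_law refl] refl])
  have lower: "- K \<le> regret T R (p s) disturbance (costs \<epsilon>)" if "\<epsilon> \<in> signs T" for \<epsilon> s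
    using regret_ge[OF that] by (simp add: K_def)
  have nonneg: "0 \<le> regret T R (p s) disturbance (costs \<epsilon>) + K" if "\<epsilon> \<in> signs T" for \<epsilon> s
    using lower[OF that, of s] by simp
  have "ennreal (L + K) = (\<integral>\<^sup>+ s. ennreal (L + K) \<partial>\<nu>)" by (simp add: \<nu>.emeasure_space_1)
  also have "\<dots> \<le> (\<integral>\<^sup>+ s. (\<Sum>\<epsilon>\<in>signs T. ennreal (1 / 2 ^ T) * ennreal (regret T R (p s) disturbance (costs \<epsilon>) + K)) \<partial>\<nu>)"
  proof (rule nn_integral_mono)
    fix s
    have "L + K \<le> sign_avg T (\<lambda>\<epsilon>. regret T R (p s) disturbance (costs \<epsilon>) + K)"
      using avg[of "p s"] by (simp add: sign_avg_add sign_avg_const)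
    also have "\<dots> = (\<Sum>\<epsilon>\<in>signs T. 1 / 2 ^ T * (regret T R (p s) disturbance (costs \<epsilon>) + K))"
      unfolding sign_avg_def by (simp add: sum_divide_distrib)
    finally have "ennreal (L + K) \<le> ennreal (\<Sum>\<epsilon>\<in>signs T. 1 / 2 ^ T * (regret T R (p s) disturbance (costs \<epsilon>) + K))"
      by (rule ennreal_leI)
    also have "\<dots> = (\<Sum>\<epsilon>\<in>signs T. ennreal (1 / 2 ^ T * (regret T R (p s) disturbance (costs \<epsilon>) + K)))"
      using nonneg by (intro sum_ennreal[symmetric] mult_nonneg_nonneg) auto
    also have "\<dots> = (\<Sum>\<epsilon>\<in>signs T. ennreal (1 / 2 ^ T) * ennreal (regret T R (p s) disturbance (costs \<epsilon>) + K))"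
      by (intro sum.cong refl ennreal_mult') simp
    finally show "ennreal (L + K) \<le> (\<Sum>\<epsilon>\<in>signs T. ennreal (1 / 2 ^ T) * ennreal (regret T R (p s) disturbance (costs \<epsilon>) + K))" .
  qed
  also have "\<dots> = (\<Sum>\<epsilon>\<in>signs T. ennreal (1 / 2 ^ T) * (\<integral>\<^sup>+ s. ennreal (regret T R (p s) disturbance (costs \<epsilon>) + K) \<partial>\<nu>))"
    using regret_measurable[OF c]
    by (subst nn_integral_sum) (auto intro!: sum.cong nn_integral_cmult)
  also have "\<dots> = (\<integral>\<^sup>+ x. \<integral>\<^sup>+ s. ennreal (?X (x, s) + K) \<partial>\<nu> \<partial>law)"
    unfolding nn_integral_law by (simp add: env_def)
  also have "\<dots> = (\<integral>\<^sup>+ z. ennreal (?X z + K) \<partial>(law \<Otimes>\<^sub>M \<nu>))"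
    by (rule \<nu>.nn_integral_fst[of "\<lambda>z. ennreal (?X z + K)"]) measurable
  finally have le: "ennreal (L + K) \<le> (\<integral>\<^sup>+ z. ennreal (?X z + K) \<partial>(law \<Otimes>\<^sub>M \<nu>))" .
  show ?thesis
  proof (rule expectation_of_bounded_below[OF _ X K _ L le])
    show "prob_space (law \<Otimes>\<^sub>M \<nu>)" using prob_space_law \<open>prob_space \<nu>\<close> by (rule prob_space_pair)
    show "- K \<le> ?X z" if "z \<in> space (law \<Otimes>\<^sub>M \<nu>)" for z
      using that lower by (auto simp: space_pair_measure space_law env_def)
  qed
qed

end

text \<open>Rudin-Shapiro blocks have length \<open>2 ^ m\<close>; such a block can be chosen with
  twice its length at most \<open>T\<close> and four times its length above
  \<open>T\<close>.\<close>

lemma exists_power_of_two: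
  fixes T :: nat
  assumes "2 \<le> T"
  shows "\<exists>m. 2 * 2 ^ m \<le> T \<and> T < 4 * 2 ^ m"
proof -
  obtain n where n: "2 ^ n \<le> T" "T < 2 ^ (n + 1)"
    using ex_power_ivl1[of 2 T] assms by auto
  have "n \<noteq> 0" using n(2) assms by (cases n) auto
  then obtain m where "n = Suc m" by (cases n) auto
  then show ?thesis using n by (intro exI[of _ m]) simp
qed

theorem regret_lower_bound:
  "\<exists>T\<^sub>0::nat. \<forall>T\<ge>T\<^sub>0. \<forall>W R \<mu> G :: real.
     0 < W \<and> 0 < R \<and> 0 < \<mu> \<and> 4 * \<mu> \<le> G \<longrightarrow>
     (let D = W * (1 + 3 * exp 1 * R) in
       \<exists>M. oblivious_law T M \<and>
         (AE (w, f) in M. \<forall>t\<in>{1..T}. \<bar>w t\<bar> \<le> W \<and>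
            strongly_convex \<mu> (f t) \<and> regular_cost G D (f t)) \<and>
         (\<forall>N p. randomized_controller T M N p \<longrightarrow>
            has_expectation (M \<Otimes>\<^sub>M N) (\<lambda>((w, f), s). regret T R (p s) w f) \<and>
            expect (M \<Otimes>\<^sub>M N) (\<lambda>((w, f), s). regret T R (p s) w f)
              \<ge> ereal (1 / 512 * G * D * W * R * sqrt (real T * ln (exp 1 * real T)))))"
proof -
  obtain N\<^sub>0 :: nat where N\<^sub>0: "\<And>N::nat. N\<^sub>0 \<le> N \<Longrightarrow> \<exists>(\<eta>::real) B::real. 0 < \<eta> \<and> \<eta>\<^sup>2 \<le> 2 \<and>
     exp (real N * \<eta> ^ 4 / 2) * (1 + \<eta>\<^sup>2 * sqrt (2 * real N) * exp (\<eta>\<^sup>2 * real N)) \<le> 9 / 8 \<and>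
     B = real N * (\<eta>\<^sup>2 / 2 - \<eta> ^ 4 / 4) - ln 2 \<and> 0 \<le> B \<and>
     1 / 512 * sqrt (4 * real N * ln (exp 1 * (4 * real N))) \<le> B / (8 * \<eta>) - exp (2 * \<eta>\<^sup>2 * real N) / 2"
    using eventually_compose_filterlim[OF eventually_parameters filterlim_real_sequentially]
    unfolding eventually_sequentially by blast
  show ?thesis
  \<comment> \<open>The 2 allows a block length to be chosen, and \<open>T < 4 * N\<close> makes
    \<open>4 * N\<^sub>0 \<le> T\<close> force \<open>N\<^sub>0 \<le> N\<close>.\<close>
  proof (intro exI[of _ "max 2 (4 * N\<^sub>0)"] allI impI, elim conjE)
    fix T :: nat and W R \<mu> G :: real
    assume T: "max 2 (4 * N\<^sub>0) \<le> T" and "0 < W" "0 < R" "0 < \<mu>" "4 * \<mu> \<le> G"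
    define D where "D = W * (1 + 3 * exp 1 * R)"
    obtain m where m: "2 * 2 ^ m \<le> T" "T < 4 * 2 ^ m" using exists_power_of_two[of T] T by auto
    define N :: nat where "N = 2 ^ m"
    obtain r :: "nat \<Rightarrow> real" where r: "\<And>s. \<bar>r s\<bar> = (if s \<in> {1..2 ^ m} then 1 else 0)"
      "\<And>a n T. (\<Sum>t = 1..T. (\<Sum>i = 1..n. a i * lag r t i)\<^sup>2) \<le> 2 * 2 ^ m * (\<Sum>i = 1..n. (a i)\<^sup>2)"
      using exists_flat_sequence[of m] by blast
    interpret hard_instance N T r W R \<mu> G D
    proof unfold_locales
      show "1 \<le> N" "2 * N \<le> T" using m by (simp_all add: N_def)
      show "\<bar>r s\<bar> = (if s \<in> {1..N} then 1 else 0)" for s using r(1) by (simp add: N_def)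
      show "(\<Sum>t = 1..n. (\<Sum>i = 1..k. a i * lag r t i)\<^sup>2) \<le> 2 * real N * (\<Sum>i = 1..k. (a i)\<^sup>2)" for n k a
        using r(2)[of a k n] by (simp add: N_def)
    qed (simp_all add: \<open>0 < W\<close> \<open>0 < R\<close> \<open>0 < \<mu>\<close> \<open>4 * \<mu> \<le> G\<close> D_def)
    have "N\<^sub>0 \<le> N" using T m by (simp add: N_def)
    from N\<^sub>0[OF this] obtain \<eta> :: real and B :: real where \<eta>: "0 < \<eta>" "\<eta>\<^sup>2 \<le> 2"
      "exp (real N * \<eta> ^ 4 / 2) * (1 + \<eta>\<^sup>2 * sqrt (2 * real N) * exp (\<eta>\<^sup>2 * real N)) \<le> 9 / 8"
      "B = real N * (\<eta>\<^sup>2 / 2 - \<eta> ^ 4 / 4) - ln 2" "0 \<le> B"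
      and large: "1 / 512 * sqrt (4 * real N * ln (exp 1 * (4 * real N))) \<le> B / (8 * \<eta>) - exp (2 * \<eta>\<^sup>2 * real N) / 2"
      by blast
    obtain p :: "(nat \<Rightarrow> real) \<Rightarrow> nat \<Rightarrow> real" where p: "\<And>\<epsilon> i. 0 \<le> p \<epsilon> i" "\<And>\<epsilon>. (\<Sum>i = 1..N. p \<epsilon> i) \<le> 1"
      "B / (8 * \<eta>) - exp (2 * \<eta>\<^sup>2 * real N) / 2 \<le>
        sign_avg T (\<lambda>\<epsilon>. (\<Sum>i = 1..N. p \<epsilon> i * corr \<epsilon> i) / 4 - N * (\<Sum>i = 1..N. (p \<epsilon> i)\<^sup>2) / 8)"
      using exists_weights[OF \<eta>] by blast
    define L where "L = 1 / 512 * G * D * W * R * sqrt (real T * ln (exp 1 * real T))"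
    have "real T \<le> real (4 * N)" using m by (intro of_nat_mono) (simp add: N_def)
    then have T1: "1 \<le> real T" "real T \<le> 4 * real N" using T by simp_all
    have "0 < G" using pos G by linarith
    have L0: "0 \<le> L"
      using pos D_ge \<open>0 < G\<close> ln_exp_times_le(1)[OF T1(1)] by (simp add: L_def)
    have "1 \<le> exp 1 * real T" using mult_mono[of 1 "exp 1" 1 "real T"] T1 by simp
    then have "sqrt (real T * ln (exp 1 * real T)) \<le> sqrt (4 * real N * ln (exp 1 * (4 * real N)))"
      using T1 by (intro real_sqrt_le_mono mult_mono ln_mono) auto
    then have "1 / 512 * sqrt (real T * ln (exp 1 * real T)) \<le>
        sign_avg T (\<lambda>\<epsilon>. (\<Sum>i = 1..N. p \<epsilon> i * corr \<epsilon> i) / 4 - N * (\<Sum>i = 1..N. (p \<epsilon> i)\<^sup>2) / 8)"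
      using large p(3) by linarith
    then have gain: "G * D * W * R * (1 / 512 * sqrt (real T * ln (exp 1 * real T))) \<le>
        G * D * W * R * sign_avg T (\<lambda>\<epsilon>. (\<Sum>i = 1..N. p \<epsilon> i * corr \<epsilon> i) / 4 - N * (\<Sum>i = 1..N. (p \<epsilon> i)\<^sup>2) / 8)"
      using pos D_ge \<open>0 < G\<close> by (intro mult_left_mono) auto
    have avg: "L \<le> sign_avg T (\<lambda>\<epsilon>. regret T R \<pi> disturbance (costs \<epsilon>))" for \<pi>
    proof -
      have "L = G * D * W * R * (1 / 512 * sqrt (real T * ln (exp 1 * real T)))" by (simp add: L_def)
      also note gain
      also note sign_avg_regret[OF p(1,2)]
      finally show ?thesis .
    qed
    show "let D = W * (1 + 3 * exp 1 * R) in
       \<exists>M. oblivious_law T M \<and>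
         (AE (w, f) in M. \<forall>t\<in>{1..T}. \<bar>w t\<bar> \<le> W \<and>
            strongly_convex \<mu> (f t) \<and> regular_cost G D (f t)) \<and>
         (\<forall>N p. randomized_controller T M N p \<longrightarrow>
            has_expectation (M \<Otimes>\<^sub>M N) (\<lambda>((w, f), s). regret T R (p s) w f) \<and>
            expect (M \<Otimes>\<^sub>M N) (\<lambda>((w, f), s). regret T R (p s) w f)
              \<ge> ereal (1 / 512 * G * D * W * R * sqrt (real T * ln (exp 1 * real T))))"
      unfolding Let_def D_def[symmetric] L_def[symmetric]
    proof (intro exI[of _ law] conjI[OF oblivious_law] conjI[OF AE_law] allI impI)
      fix \<nu> \<pi> assume c: "randomized_controller T law \<nu> \<pi>"
      show "has_expectation (law \<Otimes>\<^sub>M \<nu>) (\<lambda>((w, f), s). regret T R (\<pi> s) w f) \<and>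
          ereal L \<le> expect (law \<Otimes>\<^sub>M \<nu>) (\<lambda>((w, f), s). regret T R (\<pi> s) w f)"
        using c L0 avg by (rule expected_regret)
    qed
  qed
qed

theorem theorem6p4:
  shows
    "(\<exists>c>0. \<exists>T\<^sub>0::nat. \<forall>T\<ge>T\<^sub>0. \<forall>W R \<mu> G :: real.
        0 < W \<and> 0 < R \<and> 0 < \<mu> \<and> 4 * \<mu> \<le> G \<longrightarrow>
        (let D = W * (1 + 3 * exp 1 * R) in
          \<exists>M. oblivious_law T M \<and>
              (AE (w, f) in M. \<forall>t\<in>{1..T}. \<bar>w t\<bar> \<le> W \<and>
                 strongly_convex \<mu> (f t) \<and> regular_cost G D (f t)) \<and>
              (\<forall>N p. randomized_controller T M N p \<longrightarrow>
                 has_expectation (M \<Otimes>\<^sub>M N) (\<lambda>((w, f), s). regret T R (p s) w f) \<and>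
                 expect (M \<Otimes>\<^sub>M N) (\<lambda>((w, f), s). regret T R (p s) w f)
                   \<ge> ereal (c * G * D * W * R * sqrt (real T * ln (exp 1 * real T))))))
     \<and>
     (\<exists>C::real. \<forall>T\<ge>1::nat. \<forall>W R G :: real.
        0 < W \<and> 0 < R \<and> 0 < G \<longrightarrow>
        (let D = W * (1 + 3 * exp 1 * R) in
          \<exists>p::policy. \<forall>w f.
            (\<forall>t\<in>{1..T}. \<bar>w t\<bar> \<le> W \<and> regular_cost G D (f t)) \<longrightarrow>
            regret T R p w f \<le> C * G * D * W * R * sqrt (real T * ln (exp 1 * real T))))"
proof (rule conjI, goal_cases)
  case 1
  show ?case
    by (rule exI[of _ "1 / 512"], rule conjI[OF _ regret_lower_bound]) simp
next
  case 2
  show ?case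
    unfolding Let_def
    by (intro exI[of _ 20] allI impI, elim conjE, rule regret_upper_bound[OF _ _ _ _ refl])
qed

end
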